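(* Let $(\Sigma,\mathcal{T})$ be an ideally triangulated compact 3-dimensional manifold with boundary, with hyper-ideal vertex set $V=\{1,\dots,N\}$ and edge set $E$, and let $\Phi: E\to[0,\arccos\frac13]$ be a weight. Then generalized Thurston's sphere packing metrics on $(\Sigma,\mathcal{T},\Phi)$ cannot be deformed while keeping the combinatorial Ricci curvatures along the edges fixed: for every generalized Thurston's sphere packing metric $\overline{r}\in\Omega(\Phi)$ there is a neighborhood $U\subseteq\Omega(\Phi)$ of $\overline{r}$ such that if $r\in U$ satisfies $K_{ij}(r)=K_{ij}(\overline{r})$ for every edge $\{ij\}\in E$, then $r=\overline{r}$.
   Context: $\Sigma$ is obtained from a compact 3-manifold $\widetilde\Sigma$ whose boundary has $N$ components by coning each boundary component to a point; an ideal triangulation $\mathcal{T}$ is a triangulation of $\Sigma$ whose vertices are exactly these cone points. Each tetrahedron of $\mathcal T$ is realized as a hyper-ideal tetrahedron: a compact convex polyhedron in $\mathbb{H}^3$ diffeomorphic to a truncated Euclidean tetrahedron, with four right-angled hyperbolic hexagonal faces and four hyperbolic triangular faces ("vertex triangles" $\triangle_i$, one for each vertex $i$), each vertex triangle orthogonal to its three adjacent hexagons; the edge $\{ij\}$ is the intersection of two hexagonal faces and joins $\triangle_i$ to $\triangle_j$; $l_{ij}$ denotes its length. Gluing is by isometries of hexagonal faces. A generalized Thurston's sphere packing metric on $(\Sigma,\mathcal T,\Phi)$ is a map $r:V\to(0,\infty)$ such that, setting $l_{ij}=\cosh^{-1}(\sinh r_i\sinh r_j+\cos\Phi_{ij}\cosh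 r_i\cosh r_j)$ for each edge, for every tetrahedron $\{ijkh\}\in T$ the six numbers $l_{ij},l_{ik},l_{ih},l_{jk},l_{jh},l_{kh}$ are the edge lengths of a (non-degenerate) hyper-ideal tetrahedron. The set of all such $r$ is the admissible space $\Omega(\Phi)\subseteq\mathbb{R}^N_{>0}$. The combinatorial Ricci curvature along an edge is $K_{ij}=2\pi-\sum_{\{ijkh\}\in T}\beta_{ij,kh}$, where $\beta_{ij,kh}$ is the dihedral angle at edge $\{ij\}$ of the hyper-ideal tetrahedron $\{ijkh\}$, summed over all tetrahedra containing $\{ij\}$. *)

theory Defs
  imports "HOL-Analysis.Analysis"
begin

(* Corners of a tetrahedron are indexed by the numeral type 4 (elements 0,1,2,3). *)

section \<open>Hyperboloid (Minkowski) model\<close>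

(* Minkowski form of signature (3,1) on R^4, coordinate 0 is the time-like one. *)
definition mink :: "real^4 \<Rightarrow> real^4 \<Rightarrow> real" where
  "mink x y = (\<Sum>i\<in>UNIV. x$i * y$i) - 2 * (x$0 * y$0)"

(* Six positive numbers l a b (a \<noteq> b, symmetric) are the edge lengths of a
   (non-degenerate) hyper-ideal tetrahedron: in the hyperboloid model the
   truncating plane of vertex a is the polar plane of a unit space-like vector v a,
   the four poles are linearly independent, and the distance between the truncating
   planes of a and b (= length of edge ab) satisfies cosh l_ab = - <v a, v b>. *)
definition hyperideal_tet :: "(4 \<Rightarrow> 4 \<Rightarrow> real) \<Rightarrow> bool" where
  "hyperideal_tet l \<longleftrightarrow>
     (\<forall>a b. a \<noteq> b \<longrightarrow> l a b > 0 \<and> l a b = l b a) \<and>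
     (\<exists>v :: 4 \<Rightarrow> real^4.
        inj v \<and> independent (range v) \<and>
        (\<forall>a. mink (v a) (v a) = 1) \<and>
        (\<forall>a b. a \<noteq> b \<longrightarrow> mink (v a) (v b) = - cosh (l a b)))"

(* Gram matrix of the poles v a. *)
definition gram :: "(4 \<Rightarrow> 4 \<Rightarrow> real) \<Rightarrow> real^4^4" where
  "gram l = (\<chi> a b. if a = b then 1 else - cosh (l a b))"

(* Dihedral angle at the edge ab (with k,h the two remaining corners).  The inward
   normal of the face opposite corner k is the dual vector w k (mink (w k) (v c) = [k=c]),
   and mink (w k) (w h) = (gram l)^{-1}_{kh}; the interior dihedral angle between the
   faces opposite k and h is arccos (- <w k,w h> / (|w k| |w h|)). *)
definition dihedral :: "(4 \<Rightarrow> 4 \<Rightarrow> real) \<Rightarrow> 4 \<Rightarrow> 4 \<Rightarrow> real" where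
  "dihedral l a b =
     (THE \<theta>. \<exists>k h. k \<noteq> h \<and> {k, h} = UNIV - {a, b} \<and>
        \<theta> = arccos (- (matrix_inv (gram l))$k$h /
                   sqrt ((matrix_inv (gram l))$k$k * (matrix_inv (gram l))$h$h)))"

section \<open>Ideal triangulations (combinatorial data)\<close>

(* Tetrahedra: a finite set T.  vert t a: the (hyper-ideal) vertex of V = {1..N} at
   corner a of t.  Faces are pairs (t,h) (the face of t opposite corner h);
   fp pairs faces, fg (t,h) is the corner bijection realizing the gluing of
   face (t,h) onto face fp (t,h).  edge t a b \<in> E is the edge of the triangulation
   carried by the tetrahedron edge between corners a \<noteq> b. *)

(* One gluing step on corners / tetrahedron edges *)
definition corner_step :: "('t \<times> 4 \<Rightarrow> 't \<times> 4) \<Rightarrow> ('t \<times> 4 \<Rightarrow> 4 \<Rightarrow> 4) \<Rightarrow> 't set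
    \<Rightarrow> (('t \<times> 4) \<times> ('t \<times> 4)) set" where
  "corner_step fp fg T = {((t, a), (fst (fp (t, h)), fg (t, h) a)) | t a h. t \<in> T \<and> a \<noteq> h}"

definition edge_step :: "('t \<times> 4 \<Rightarrow> 't \<times> 4) \<Rightarrow> ('t \<times> 4 \<Rightarrow> 4 \<Rightarrow> 4) \<Rightarrow> 't set
    \<Rightarrow> (('t \<times> 4 \<times> 4) \<times> ('t \<times> 4 \<times> 4)) set" where
  "edge_step fp fg T =
     {((t, a, b), (fst (fp (t, h)), fg (t, h) a, fg (t, h) b)) | t a b h.
         t \<in> T \<and> a \<noteq> b \<and> a \<noteq> h \<and> b \<noteq> h}
     \<union> {((t, a, b), (t, b, a)) | t a b. t \<in> T \<and> a \<noteq> b}"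

definition ideal_triangulation ::
  "nat \<Rightarrow> 't set \<Rightarrow> ('t \<Rightarrow> 4 \<Rightarrow> nat) \<Rightarrow> ('t \<times> 4 \<Rightarrow> 't \<times> 4)
     \<Rightarrow> ('t \<times> 4 \<Rightarrow> 4 \<Rightarrow> 4) \<Rightarrow> 'e set \<Rightarrow> ('t \<Rightarrow> 4 \<Rightarrow> 4 \<Rightarrow> 'e) \<Rightarrow> bool" where
  "ideal_triangulation N T vert fp fg E edge \<longleftrightarrow>
     finite T \<and> T \<noteq> {} \<and> finite E \<and>
     \<comment> \<open>face pairing: fixed-point free involution on the faces, realized by corner bijections\<close>
     (\<forall>t\<in>T. \<forall>h. fst (fp (t, h)) \<in> T \<and> fp (t, h) \<noteq> (t, h) \<and> fp (fp (t, h)) = (t, h) \<and>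
        bij (fg (t, h)) \<and> fg (t, h) h = snd (fp (t, h)) \<and>
        fg (fp (t, h)) \<circ> fg (t, h) = id) \<and>
     \<comment> \<open>vertices: V = {1..N}, and vertices of the triangulation are exactly the classes
         of corners under the gluing\<close>
     (\<forall>t\<in>T. \<forall>a. vert t a \<in> {1..N}) \<and>
     (\<forall>i\<in>{1..N}. \<exists>t\<in>T. \<exists>a. vert t a = i) \<and>
     (\<forall>t\<in>T. \<forall>a. \<forall>t'\<in>T. \<forall>a'.
        vert t a = vert t' a' \<longleftrightarrow> ((t, a), (t', a')) \<in> (corner_step fp fg T)\<^sup>*) \<and>
     \<comment> \<open>edges: E is exactly the set of classes of tetrahedron edges under the gluing\<close>
     (\<forall>t\<in>T. \<forall>a b. a \<noteq> b \<longrightarrow> edge t a b \<in> E) \<and>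
     (\<forall>e\<in>E. \<exists>t\<in>T. \<exists>a b. a \<noteq> b \<and> edge t a b = e) \<and>
     (\<forall>t\<in>T. \<forall>a b. \<forall>t'\<in>T. \<forall>a' b'. a \<noteq> b \<longrightarrow> a' \<noteq> b' \<longrightarrow>
        (edge t a b = edge t' a' b' \<longleftrightarrow> ((t, a, b), (t', a', b')) \<in> (edge_step fp fg T)\<^sup>*))"

section \<open>Generalized Thurston sphere packing metrics\<close>

(* argument of cosh^{-1} in the edge length formula *)
definition len_arg :: "real \<Rightarrow> real \<Rightarrow> real \<Rightarrow> real" where
  "len_arg \<phi> ri rj = sinh ri * sinh rj + cos \<phi> * cosh ri * cosh rj"

(* edge lengths of the tetrahedron t determined by r *)
definition tet_len :: "('t \<Rightarrow> 4 \<Rightarrow> nat) \<Rightarrow> ('t \<Rightarrow> 4 \<Rightarrow> 4 \<Rightarrow> 'e) \<Rightarrow> ('e \<Rightarrow> real)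
     \<Rightarrow> (nat \<Rightarrow> real) \<Rightarrow> 't \<Rightarrow> 4 \<Rightarrow> 4 \<Rightarrow> real" where
  "tet_len vert edge \<Phi> r t a b = arcosh (len_arg (\<Phi> (edge t a b)) (r (vert t a)) (r (vert t b)))"

(* admissible space \<Omega>(\<Phi>); metrics r : V \<rightarrow> (0,\<infinity>) are represented as functions
   nat \<Rightarrow> real that vanish outside V = {1..N}. *)
definition admissible :: "nat \<Rightarrow> 't set \<Rightarrow> ('t \<Rightarrow> 4 \<Rightarrow> nat) \<Rightarrow> ('t \<Rightarrow> 4 \<Rightarrow> 4 \<Rightarrow> 'e)
     \<Rightarrow> ('e \<Rightarrow> real) \<Rightarrow> (nat \<Rightarrow> real) set" where
  "admissible N T vert edge \<Phi> =
     {r. (\<forall>i\<in>{1..N}. r i > 0) \<and> (\<forall>i. i \<notin> {1..N} \<longrightarrow> r i = 0) \<and>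
         (\<forall>t\<in>T. (\<forall>a b. a \<noteq> b \<longrightarrow>
                     len_arg (\<Phi> (edge t a b)) (r (vert t a)) (r (vert t b)) \<ge> 1) \<and>
                 hyperideal_tet (tet_len vert edge \<Phi> r t))}"

(* combinatorial Ricci curvature along the edge e: 2\<pi> minus the sum of the dihedral
   angles at all tetrahedron edges glued to e *)
definition ricci :: "'t set \<Rightarrow> ('t \<Rightarrow> 4 \<Rightarrow> nat) \<Rightarrow> ('t \<Rightarrow> 4 \<Rightarrow> 4 \<Rightarrow> 'e) \<Rightarrow> ('e \<Rightarrow> real)
     \<Rightarrow> (nat \<Rightarrow> real) \<Rightarrow> 'e \<Rightarrow> real" where
  "ricci T vert edge \<Phi> r e =
     2 * pi - (\<Sum>(t, a, b) \<in> {(t, a, b). t \<in> T \<and> a < b \<and> edge t a b = e}.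
                 dihedral (tet_len vert edge \<Phi> r t) a b)"

end

theory Submission
  imports Defs
begin

text \<open>
  On a hyper-ideal tetrahedron the Jacobian of the dihedral angles with respect to the edge lengths
  is, after scaling rows and columns by the hyperbolic sines of the lengths, a symmetric matrix
  that is a rational function of the Gram matrix.  It is nondegenerate because the dihedral angles
  determine the inverse Gram matrix up to a diagonal rescaling, it is positive definite at a
  regular tetrahedron, and the space of hyper-ideal tetrahedra is connected, being convex in
  coordinates attached to a vertex triangle.  So it is positive definite everywhere, and for edge
  lengths near those of \<open>rbar\<close> the pairing of the length difference with the angle difference is
  positive unless the lengths agree.  Summed over all tetrahedra this pairing is
  the pairing of the edge length difference with minus the curvature difference, which vanishes.
  Hence all edge lengths agree.  As an edge length is strictly increasing in both radii, the radii
  at the corners of a face could only differ with pairwise opposite signs, which is impossible for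
  three corners.
\<close>

section \<open>Dihedral angles in terms of edge cosines\<close>

text \<open>Definiteness is hard to read off the explicit 6 by 6 matrix, whereas invertibility has a
  conceptual reason; hence the detour through a path along which the form cannot degenerate. The
  symmetry is the one behind the Schlaefli formula, but no volume function occurs: it is visible in
  the cofactor form of the entries. Passing to hyperbolic cosines of the lengths makes everything
  rational, up to the hyperbolic sines and the common factor \<open>sqrt (- gram_det)\<close>. The
  bound on the weights makes their cosines at least 1/3, hence positive, and this is what lets each
  length increase in both radii.\<close>

text \<open>Write \<open>x, y, z, \<dots>\<close> for the hyperbolic cosines of edge lengths.  The Gram matrix of the four poles
  has ones on the diagonal and the negatives of these cosines off it.  Its diagonal cofactors are
  \<open>- face_minor\<close> (three edges of a face) and its off-diagonal ones are \<open>edge_cofactor\<close>: for the tetrahedron edge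
  \<open>ab\<close> with opposite edge \<open>kh\<close>, \<open>edge_cofactor ab ka kb ha hb kh\<close> is the \<open>(k, h)\<close> cofactor.\<close>

definition face_minor :: "real \<Rightarrow> real \<Rightarrow> real \<Rightarrow> real" where
  "face_minor x y z = x^2 + y^2 + z^2 + 2*x*y*z - 1"

definition edge_cofactor :: "real \<Rightarrow> real \<Rightarrow> real \<Rightarrow> real \<Rightarrow> real \<Rightarrow> real \<Rightarrow> real" where
  "edge_cofactor x y z y' z' w = y*y' + z*z' + x*(y*z' + z*y') - w*(x^2 - 1)"

text \<open>The arguments of \<open>gram_det\<close> are the edges in the order 01, 02, 03, 12, 13, 23, in contrast to
  the order edge, two edges at \<open>k\<close>, two edges at \<open>h\<close>, opposite edge used for a single dihedral angle.\<close>

definition gram_det :: "real \<Rightarrow> real \<Rightarrow> real \<Rightarrow> real \<Rightarrow> real \<Rightarrow> real \<Rightarrow> real" where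
  "gram_det a b c d e f = 1 - (a^2 + b^2 + c^2 + d^2 + e^2 + f^2)
     - 2*(a*b*d + a*c*e + b*c*f + d*e*f)
     + a^2*f^2 + b^2*e^2 + c^2*d^2 - 2*(a*b*e*f + a*c*d*f + b*c*d*e)"

definition dihedral_angle :: "real \<Rightarrow> real \<Rightarrow> real \<Rightarrow> real \<Rightarrow> real \<Rightarrow> real \<Rightarrow> real" where
  "dihedral_angle x y z y' z' w = arccos (edge_cofactor x y z y' z' w / sqrt (face_minor x y z * face_minor x y' z'))"

text \<open>\<open>jacobian_row\<close> is the derivative of a dihedral angle in the directions of the edge cosines, up to the
  factor \<open>sinh l / sqrt (- gram_det)\<close>.  In this normalisation the Jacobian is symmetric: the coefficient
  of the opposite edge is 1, and the one linking edges \<open>ab\<close> and \<open>ak\<close> is a cofactor quotient that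
  depends on the unordered pair only.\<close>

definition jacobian_diag :: "real \<Rightarrow> real \<Rightarrow> real \<Rightarrow> real \<Rightarrow> real \<Rightarrow> real \<Rightarrow> real" where
  "jacobian_diag x y z y' z' w = (2*x*w - y*z' - z*y'
      + edge_cofactor x y z y' z' w * ((x + y*z) / face_minor x y z + (x + y'*z') / face_minor x y' z')) / (x^2 - 1)"

definition jacobian_row :: "real \<Rightarrow> real \<Rightarrow> real \<Rightarrow> real \<Rightarrow> real \<Rightarrow> real \<Rightarrow>
    real \<Rightarrow> real \<Rightarrow> real \<Rightarrow> real \<Rightarrow> real \<Rightarrow> real \<Rightarrow> real" where
  "jacobian_row x y z y' z' w X Y Z Y' Z' W = jacobian_diag x y z y' z' w * X + W
     - (edge_cofactor z x y z' w y' * Y + edge_cofactor y x z y' w z' * Z) / face_minor x y z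
     - (edge_cofactor z' x y' z w y * Y' + edge_cofactor y' x z' y w z * Z') / face_minor x y' z'"

lemma face_minor_pos: "1 < x \<Longrightarrow> 1 < y \<Longrightarrow> 1 < z \<Longrightarrow> 0 < face_minor x y z"
proof -
  assume a: "1 < x" "1 < y" "1 < z"
  then have "1 < x^2" "0 \<le> y^2" "0 \<le> z^2" "0 \<le> x*y*z" by auto
  then show ?thesis unfolding face_minor_def by linarith
qed

text \<open>Jacobi's identity for complementary minors: the minor of the adjugate on the corners
  \<open>k, h\<close> is the determinant times the minor of the Gram matrix on \<open>a, b\<close>,
  which is \<open>1 - x^2\<close>. For negative determinant it puts the argument of arccos strictly
  between -1 and 1.\<close>

lemma face_minor_edge_cofactor: "face_minor x y z * face_minor x y' z' - (edge_cofactor x y z y' z' w)^2 = (x^2 - 1) * (- gram_det x y y' z z' w)"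
  unfolding face_minor_def edge_cofactor_def gram_det_def by algebra

text \<open>The left sides are, up to a common denominator, the partial derivatives of the cosine of
  the angle in \<open>y\<close>, \<open>z\<close>, \<open>y'\<close> and \<open>z'\<close>. The
  cofactor obtained for \<open>y\<close> belongs to \<open>z\<close>, the third edge of the face
  containing \<open>x\<close> and \<open>y\<close>; this is why the mixed entry does not depend on
  the order of \<open>x\<close> and \<open>y\<close>.\<close>

lemma edge_cofactor_coef:
  "face_minor x y z * (y' + x*z') - edge_cofactor x y z y' z' w * (y + x*z) = (x^2 - 1) * edge_cofactor z x y z' w y'"
  "face_minor x y z * (z' + x*y') - edge_cofactor x y z y' z' w * (z + x*y) = (x^2 - 1) * edge_cofactor y x z y' w z'"
  "face_minor x y' z' * (y + x*z) - edge_cofactor x y z y' z' w * (y' + x*z') = (x^2 - 1) * edge_cofactor z' x y' z w y"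
  "face_minor x y' z' * (z + x*y) - edge_cofactor x y z y' z' w * (z' + x*y') = (x^2 - 1) * edge_cofactor y' x z' y w z"
  unfolding face_minor_def edge_cofactor_def by algebra+

definition face_minor_deriv where
  "face_minor_deriv x y z X Y Z = 2*x*X + 2*y*Y + 2*z*Z + 2*(X*y*z + x*Y*z + x*y*(Z::real))"
definition edge_cofactor_deriv where
  "edge_cofactor_deriv x y z y' z' w X Y Z Y' Z' W = Y*y' + y*Y' + Z*z' + z*Z' + X*(y*z' + z*y')
     + x*(Y*z' + y*Z' + Z*y' + z*Y') - W*(x^2 - 1) - (w::real)*(2*x*X)"

text \<open>With \<open>n\<close> the cofactor and \<open>m, m'\<close> the face minors, the right
  side is the numerator in the derivative of \<open>arccos (n / sqrt (m * m'))\<close>. For a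
  vanishing row the identity says that \<open>n\<close> changes at the mean of the relative rates of
  \<open>m\<close> and \<open>m'\<close>.\<close>

lemma jacobian_row_eq:
  assumes "x^2 \<noteq> 1" "face_minor x y z \<noteq> 0" "face_minor x y' z' \<noteq> 0"
  shows "(x^2 - 1) * jacobian_row x y z y' z' w X Y Z Y' Z' W =
    edge_cofactor x y z y' z' w * (face_minor_deriv x y z X Y Z / (2 * face_minor x y z) + face_minor_deriv x y' z' X Y' Z' / (2 * face_minor x y' z'))
    - edge_cofactor_deriv x y z y' z' w X Y Z Y' Z' W"
proof -
  define m where "m = face_minor x y z"
  define m' where "m' = face_minor x y' z'"
  define n where "n = edge_cofactor x y z y' z' w"
  have nz: "m \<noteq> 0" "m' \<noteq> 0" "x^2 - 1 \<noteq> 0" using assms by (auto simp: m_def m'_def)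
  have k: "(x^2 - 1) * jacobian_diag x y z y' z' w = 2*x*w - y*z' - z*y' + n * ((x + y*z) / m + (x + y'*z') / m')"
    using nz unfolding jacobian_diag_def m_def[symmetric] m'_def[symmetric] n_def[symmetric] by simp
  have c: "(x^2 - 1) * (edge_cofactor z x y z' w y' * Y + edge_cofactor y x z y' w z' * Z) / m =
        (y' + x*z') * Y + (z' + x*y') * Z - n * ((y + x*z) * Y + (z + x*y) * Z) / m"
  proof -
    have "(x^2 - 1) * (edge_cofactor z x y z' w y' * Y + edge_cofactor y x z y' w z' * Z) =
       (m * (y' + x*z') - n * (y + x*z)) * Y + (m * (z' + x*y') - n * (z + x*y)) * Z"
      unfolding m_def n_def edge_cofactor_coef by (simp add: algebra_simps)
    then show ?thesis using nz by (simp add: field_simps)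
  qed
  have c': "(x^2 - 1) * (edge_cofactor z' x y' z w y * Y' + edge_cofactor y' x z' y w z * Z') / m' =
        (y + x*z) * Y' + (z + x*y) * Z' - n * ((y' + x*z') * Y' + (z' + x*y') * Z') / m'"
  proof -
    have "(x^2 - 1) * (edge_cofactor z' x y' z w y * Y' + edge_cofactor y' x z' y w z * Z') =
       (m' * (y + x*z) - n * (y' + x*z')) * Y' + (m' * (z + x*y) - n * (z' + x*y')) * Z'"
      unfolding m'_def n_def edge_cofactor_coef by (simp add: algebra_simps)
    then show ?thesis using nz by (simp add: field_simps)
  qed
  have "(x^2 - 1) * jacobian_row x y z y' z' w X Y Z Y' Z' W =
     ((x^2 - 1) * jacobian_diag x y z y' z' w) * X + (x^2 - 1) * W
     - (x^2 - 1) * (edge_cofactor z x y z' w y' * Y + edge_cofactor y x z y' w z' * Z) / m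
     - (x^2 - 1) * (edge_cofactor z' x y' z w y * Y' + edge_cofactor y' x z' y w z * Z') / m'"
    unfolding jacobian_row_def m_def m'_def by (simp add: algebra_simps)
  also have "\<dots> = n * (face_minor_deriv x y z X Y Z / (2 * m) + face_minor_deriv x y' z' X Y' Z' / (2 * m'))
    - edge_cofactor_deriv x y z y' z' w X Y Z Y' Z' W"
    unfolding k c c' face_minor_deriv_def edge_cofactor_deriv_def using nz by (simp add: field_simps)
  finally show ?thesis unfolding m_def m'_def n_def .
qed

lemma has_derivative_face_minor:
  assumes "(x has_real_derivative X) (at t)" "(y has_real_derivative Y) (at t)" "(z has_real_derivative Z) (at t)"
  shows "((\<lambda>t. face_minor (x t) (y t) (z t)) has_real_derivative face_minor_deriv (x t) (y t) (z t) X Y Z) (at t)"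
  unfolding face_minor_def face_minor_deriv_def
  by (rule derivative_eq_intros assms refl | simp add: algebra_simps)+

lemma has_derivative_edge_cofactor:
  assumes "(x has_real_derivative X) (at t)" "(y has_real_derivative Y) (at t)" "(z has_real_derivative Z) (at t)"
   "(y' has_real_derivative Y') (at t)" "(z' has_real_derivative Z') (at t)" "(w has_real_derivative W) (at t)"
  shows "((\<lambda>t. edge_cofactor (x t) (y t) (z t) (y' t) (z' t) (w t)) has_real_derivative
     edge_cofactor_deriv (x t) (y t) (z t) (y' t) (z' t) (w t) X Y Z Y' Z' W) (at t)"
  unfolding edge_cofactor_def edge_cofactor_deriv_def
  by (rule derivative_eq_intros assms refl | simp add: algebra_simps)+

lemma cos_angle_deriv:
  fixes n m m' :: "real \<Rightarrow> real"
  assumes n: "(n has_real_derivative N) (at t)" and m: "(m has_real_derivative M) (at t)"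
    and m': "(m' has_real_derivative M') (at t)"
    and pos: "m t > 0" "m' t > 0" and lt: "(n t)^2 < m t * m' t"
  shows "((\<lambda>t. arccos (n t / sqrt (m t * m' t))) has_real_derivative
    (n t * (M / (2 * m t) + M' / (2 * m' t)) - N) / sqrt (m t * m' t - (n t)^2)) (at t)"
proof -
  define s where "s = sqrt (m t * m' t)"
  have s: "s > 0" "s^2 = m t * m' t" using pos by (auto simp: s_def)
  have "((n t)/s)^2 < 1" using lt s pos by (simp add: power_divide divide_less_eq_1)
  then have "\<bar>n t / s\<bar> < 1" by (simp only: abs_square_less_1)
  then have b: "-1 < n t / s" "n t / s < 1" by linarith+
  have "((\<lambda>t. sqrt (m t * m' t)) has_real_derivative (M * m' t + m t * M') / (2 * s)) (at t)"
    unfolding s_def using mult_pos_pos[OF pos] by (auto intro!: derivative_eq_intros m m' simp: field_simps)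
  then have "((\<lambda>t. n t / sqrt (m t * m' t)) has_real_derivative
     (N * sqrt (m t * m' t) - n t * ((M * m' t + m t * M') / (2 * s))) / (sqrt (m t * m' t) * sqrt (m t * m' t))) (at t)"
    using s(1) by (intro DERIV_divide n) (auto simp: s_def)
  then have d: "((\<lambda>t. n t / sqrt (m t * m' t)) has_real_derivative
     (N * s - n t * ((M * m' t + m t * M') / (2 * s))) / (s * s)) (at t)"
    unfolding s_def .
  have q: "sqrt (1 - (n t / s)^2) = sqrt (m t * m' t - (n t)^2) / s"
  proof -
    have "1 - (n t / s)^2 = (s^2 - (n t)^2) / s^2" using s(1) by (simp add: power_divide diff_divide_distrib)
    then show ?thesis unfolding s(2)[symmetric] using s(1) by (simp add: real_sqrt_divide)
  qed
  have "((\<lambda>t. arccos (n t / sqrt (m t * m' t))) has_real_derivative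
     inverse (- sqrt (1 - (n t / s)^2)) * ((N * s - n t * ((M * m' t + m t * M') / (2 * s))) / (s * s))) (at t)"
    using DERIV_chain2[OF DERIV_arccos d] b unfolding s_def[symmetric] by simp
  moreover have "inverse (- sqrt (1 - (n t / s)^2)) * ((N * s - n t * ((M * m' t + m t * M') / (2 * s))) / (s * s))
     = (n t * (M / (2 * m t) + M' / (2 * m' t)) - N) / sqrt (m t * m' t - (n t)^2)"
  proof -
    define D where "D = sqrt (m t * m' t - (n t)^2)"
    have D: "D > 0" using lt by (simp add: D_def)
    have "(N * s - n t * ((M * m' t + m t * M') / (2 * s))) / (s * s) = (N - n t * ((M * m' t + m t * M') / (2 * s^2))) / s"
      using s(1) by (simp add: field_simps power2_eq_square)
    also have "(M * m' t + m t * M') / (2 * s^2) = M / (2 * m t) + M' / (2 * m' t)"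
      unfolding s(2) using pos by (simp add: field_simps)
    finally have e: "(N * s - n t * ((M * m' t + m t * M') / (2 * s))) / (s * s) = (N - n t * (M / (2 * m t) + M' / (2 * m' t))) / s" .
    show ?thesis unfolding q e D_def[symmetric] using D s(1)
      by (simp add: divide_simps)
  qed
  ultimately show ?thesis by simp
qed

text \<open>By \<open>face_minor_edge_cofactor\<close> the root in \<open>cos_angle_deriv\<close>
  splits off \<open>sqrt (x^2 - 1)\<close>, which cancels half of the factor \<open>x^2 - 1\<close>
  from \<open>jacobian_row_eq\<close>. For \<open>x = cosh l\<close> the root that remains in the
  numerator is \<open>sinh l\<close>.\<close>

lemma dihedral_angle_deriv:
  assumes d: "(x has_real_derivative X) (at t)" "(y has_real_derivative Y) (at t)" "(z has_real_derivative Z) (at t)"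
   "(y' has_real_derivative Y') (at t)" "(z' has_real_derivative Z') (at t)" "(w has_real_derivative W) (at t)"
   and gt: "1 < x t" "1 < y t" "1 < z t" "1 < y' t" "1 < z' t"
   and neg: "gram_det (x t) (y t) (y' t) (z t) (z' t) (w t) < 0"
 shows "((\<lambda>t. dihedral_angle (x t) (y t) (z t) (y' t) (z' t) (w t)) has_real_derivative
   sqrt ((x t)^2 - 1) * jacobian_row (x t) (y t) (z t) (y' t) (z' t) (w t) X Y Z Y' Z' W
     / sqrt (- gram_det (x t) (y t) (y' t) (z t) (z' t) (w t))) (at t)"
proof -
  have x: "(x t)^2 > 1" using gt(1) by simp
  have m: "face_minor (x t) (y t) (z t) > 0" "face_minor (x t) (y' t) (z' t) > 0" using gt face_minor_pos by auto
  note j = face_minor_edge_cofactor[of "x t" "y t" "z t" "y' t" "z' t" "w t"]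
  have "((x t)^2 - 1) * (- gram_det (x t) (y t) (y' t) (z t) (z' t) (w t)) > 0"
    using x neg by (intro mult_pos_pos) auto
  then have lt: "(edge_cofactor (x t) (y t) (z t) (y' t) (z' t) (w t))^2 < face_minor (x t) (y t) (z t) * face_minor (x t) (y' t) (z' t)"
    using j by linarith
  note D = cos_angle_deriv[OF has_derivative_edge_cofactor[OF d] has_derivative_face_minor[OF d(1-3)] has_derivative_face_minor[OF d(1,4,5)] m lt]
  have "(edge_cofactor (x t) (y t) (z t) (y' t) (z' t) (w t)
      * (face_minor_deriv (x t) (y t) (z t) X Y Z / (2 * face_minor (x t) (y t) (z t)) + face_minor_deriv (x t) (y' t) (z' t) X Y' Z' / (2 * face_minor (x t) (y' t) (z' t)))
     - edge_cofactor_deriv (x t) (y t) (z t) (y' t) (z' t) (w t) X Y Z Y' Z' W) = ((x t)^2 - 1) * jacobian_row (x t) (y t) (z t) (y' t) (z' t) (w t) X Y Z Y' Z' W"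
    using jacobian_row_eq[of "x t" "y t" "z t" "y' t" "z' t"] x m by simp
  moreover have "((x t)^2 - 1) * R / (sqrt ((x t)^2 - 1) * q) = sqrt ((x t)^2 - 1) * R / q" for q R
  proof -
    define v where "v = sqrt ((x t)^2 - 1)"
    have "(x t)^2 - 1 = v * v" "v \<noteq> 0" using x by (auto simp: v_def)
    then show ?thesis unfolding v_def[symmetric] by simp
  qed
  ultimately show ?thesis using D unfolding dihedral_angle_def j real_sqrt_mult by simp
qed

section \<open>The Gram matrix of the poles, its adjugate and their variation\<close>

lemma UNIV_corners: "UNIV = {0, 1, 2, 3 :: 4}"
  using UNIV_4 by auto

lemma corners_less: "(0::4) < 1" "(0::4) < 2" "(0::4) < 3" "(1::4) < 2" "(1::4) < 3" "(2::4) < 3"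
  by (simp_all add: less_bit0_def bit0.Rep_0 bit0.Rep_1 bit0.Rep_numeral)

lemma sum_corners: "sum g (UNIV :: 4 set) = g 0 + g 1 + g 2 + (g 3 :: real)"
  unfolding UNIV_corners by simp

lemma forall_corners: "(\<forall>i::4. P i) \<longleftrightarrow> P 0 \<and> P 1 \<and> P 2 \<and> P 3"
  using UNIV_corners by (metis UNIV_I insertE singletonD)

definition at_corner :: "4 \<Rightarrow> 'a \<Rightarrow> 'a \<Rightarrow> 'a \<Rightarrow> 'a \<Rightarrow> 'a" where
  "at_corner i p q r s = (if i = 0 then p else if i = 1 then q else if i = 2 then r else s)"

lemma at_corner_simps [simp]: "at_corner 0 p q r s = p" "at_corner 1 p q r s = q" "at_corner 2 p q r s = r" "at_corner 3 p q r s = s"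
  by (simp_all add: at_corner_def)

definition sym_matrix :: "real \<Rightarrow> real \<Rightarrow> real \<Rightarrow> real \<Rightarrow> real \<Rightarrow> real \<Rightarrow> real \<Rightarrow> real \<Rightarrow> real \<Rightarrow> real \<Rightarrow> real^4^4" where
  "sym_matrix p q r s a b c d e f =
     (\<chi> i j. at_corner i (at_corner j p a b c) (at_corner j a q d e) (at_corner j b d r f) (at_corner j c e f s))"

definition pole_gram :: "real \<Rightarrow> real \<Rightarrow> real \<Rightarrow> real \<Rightarrow> real \<Rightarrow> real \<Rightarrow> real^4^4" where
  "pole_gram a b c d e f = sym_matrix 1 1 1 1 (-a) (-b) (-c) (-d) (-e) (-f)"

definition pole_adj :: "real \<Rightarrow> real \<Rightarrow> real \<Rightarrow> real \<Rightarrow> real \<Rightarrow> real \<Rightarrow> real^4^4" where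
  "pole_adj a b c d e f = sym_matrix (- face_minor d e f) (- face_minor b c f) (- face_minor a c e) (- face_minor a b d)
     (edge_cofactor f b c d e a) (edge_cofactor e a c d f b) (edge_cofactor d a b e f c)
     (edge_cofactor c a e b f d) (edge_cofactor b a d c f e) (edge_cofactor a b d c e f)"

lemma pole_gram_pole_adj:
  "pole_gram a b c d e f ** pole_adj a b c d e f = gram_det a b c d e f *\<^sub>R mat 1"
  "pole_adj a b c d e f ** pole_gram a b c d e f = gram_det a b c d e f *\<^sub>R mat 1"
  unfolding vec_eq_iff forall_corners matrix_matrix_mult_def sum_corners pole_gram_def pole_adj_def sym_matrix_def mat_def
  by (simp_all add: face_minor_def edge_cofactor_def gram_det_def, simp_all add: algebra_simps power2_eq_square)

text \<open>Jacobi's formula for the differential of a determinant. Each edge occupies two symmetric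
  entries of the Gram matrix, both with a minus sign, hence the factor -2.\<close>

definition gram_det_deriv :: "real \<Rightarrow> real \<Rightarrow> real \<Rightarrow> real \<Rightarrow> real \<Rightarrow> real \<Rightarrow> real \<Rightarrow> real \<Rightarrow> real \<Rightarrow> real \<Rightarrow> real \<Rightarrow> real \<Rightarrow> real" where
  "gram_det_deriv a b c d e f A B C D E F = - 2 * (A * edge_cofactor f b c d e a + B * edge_cofactor e a c d f b + C * edge_cofactor d a b e f c
    + D * edge_cofactor c a e b f d + E * edge_cofactor b a d c f e + F * edge_cofactor a b d c e f)"

text \<open>The product rule for \<open>pole_gram_pole_adj(1)\<close>; the variation of the Gram matrix, whose diagonal vanishes, is
  written as \<open>pole_gram A B C D E F - mat 1\<close>.\<close>

lemma pole_gram_pole_adj_deriv: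
  "pole_gram A B C D E F ** pole_adj a b c d e f - pole_adj a b c d e f
   + pole_gram a b c d e f ** sym_matrix (- face_minor_deriv d e f D E F) (- face_minor_deriv b c f B C F) (- face_minor_deriv a c e A C E) (- face_minor_deriv a b d A B D)
     (edge_cofactor_deriv f b c d e a F B C D E A) (edge_cofactor_deriv e a c d f b E A C D F B) (edge_cofactor_deriv d a b e f c D A B E F C)
     (edge_cofactor_deriv c a e b f d C A E B F D) (edge_cofactor_deriv b a d c f e B A D C F E) (edge_cofactor_deriv a b d c e f A B D C E F)
   = gram_det_deriv a b c d e f A B C D E F *\<^sub>R mat 1"
  unfolding vec_eq_iff forall_corners matrix_matrix_mult_def sum_corners pole_gram_def pole_adj_def sym_matrix_def mat_def
  by (simp_all add: face_minor_def edge_cofactor_def face_minor_deriv_def edge_cofactor_deriv_def gram_det_deriv_def, simp_all add: algebra_simps power2_eq_square)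

lemma matrix_add_rdistrib: "(A + B) ** C = A ** C + B ** (C :: real^'n^'m)"
  by (simp add: matrix_matrix_mult_def vec_eq_iff sum.distrib distrib_right)

text \<open>If a variation of \<open>G\<close> fixes all normalised entries of the inverse, its adjugate varies by a
  diagonal rescaling; the constraint that the diagonal of \<open>G\<close> stays 1 then kills the rescaling.\<close>

lemma conformal_variation_zero:
  fixes G A dG dA :: "real^'n^'n"
  assumes GA: "G ** A = \<Delta> *\<^sub>R mat 1" and AG: "A ** G = \<Delta> *\<^sub>R mat 1"
    and d: "dG ** A + G ** dA = \<delta> *\<^sub>R mat 1"
    and dA: "\<And>i j. dA $ i $ j = A $ i $ j * (\<mu> i + \<mu> j)"
    and G1: "\<And>i. G $ i $ i = 1" and dG0: "\<And>i. dG $ i $ i = 0" and nz: "\<Delta> \<noteq> 0"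
  shows "dG = 0"
proof -
  define M :: "real^'n^'n" where "M = (\<chi> i j. if i = j then \<mu> i else 0)"
  have MA: "(M ** X) $ i $ j = \<mu> i * X $ i $ j" for X :: "real^'n^'n" and i j
    by (simp add: M_def matrix_matrix_mult_def if_distrib[of "\<lambda>x. x * _"] cong: if_cong)
  have AM: "(X ** M) $ i $ j = X $ i $ j * \<mu> j" for X :: "real^'n^'n" and i j
    by (simp add: M_def matrix_matrix_mult_def if_distrib[of "\<lambda>x. _ * x"] cong: if_cong)
  have "dA = M ** A + A ** M"
    by (simp add: vec_eq_iff MA AM dA algebra_simps)
  then have "dG ** A + G ** M ** A + G ** A ** M = \<delta> *\<^sub>R mat 1"
    using d by (simp add: matrix_add_ldistrib matrix_mul_assoc add.assoc)
  then have "(dG ** A + G ** M ** A + G ** A ** M) ** G = \<delta> *\<^sub>R G"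
    by (simp add: scalar_matrix_assoc[symmetric])
  then have "dG ** (A ** G) + G ** M ** (A ** G) + \<Delta> *\<^sub>R (M ** G) = \<delta> *\<^sub>R G"
    by (simp add: GA matrix_add_rdistrib matrix_mul_assoc scalar_matrix_assoc[symmetric])
  then have "\<Delta> *\<^sub>R dG + \<Delta> *\<^sub>R (G ** M) + \<Delta> *\<^sub>R (M ** G) = \<delta> *\<^sub>R G"
    by (simp add: AG matrix_scalar_ac scalar_matrix_assoc[symmetric])
  then have e: "\<Delta> * (dG $ i $ j + G $ i $ j * (\<mu> i + \<mu> j)) = \<delta> * G $ i $ j" for i j
    by (auto simp: vec_eq_iff MA AM algebra_simps)
  \<comment> \<open>On the diagonal \<open>e\<close> reads
    \<open>2 * \<Delta> * \<mu> i = \<delta>\<close>, so all rescaling factors coincide; with this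
    value the off-diagonal equations leave \<open>\<Delta> * dG $ i $ j = 0\<close>.\<close>
  have mu: "\<mu> i = \<delta> / (2 * \<Delta>)" for i
    using e[of i i] nz by (simp add: G1 dG0 field_simps)
  show ?thesis
    unfolding vec_eq_iff using e nz by (auto simp: mu field_simps)
qed

section \<open>The angle Jacobian as a quadratic form\<close>

type_synonym six = "real \<times> real \<times> real \<times> real \<times> real \<times> real"

text \<open>What the hyper-ideal condition leaves on the edge cosines: independent poles in
  signature (3,1) force a negative Gram determinant, and nothing more about them enters the
  analysis.\<close>

fun gram_domain :: "six \<Rightarrow> bool" where
  "gram_domain (a, b, c, d, e, f) \<longleftrightarrow> 1 < a \<and> 1 < b \<and> 1 < c \<and> 1 < d \<and> 1 < e \<and> 1 < f \<and> gram_det a b c d e f < 0"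

text \<open>Each summand is the same \<open>jacobian_row\<close> for the tetrahedron relabelled so
  that its own edge stands first; this is the origin of the permuted arguments.\<close>

fun angle_form :: "six \<Rightarrow> six \<Rightarrow> six \<Rightarrow> real" where
  "angle_form (a, b, c, d, e, f) (A, B, C, D, E, F) (A', B', C', D', E', F') =
     A * jacobian_row a b d c e f A' B' D' C' E' F' + B * jacobian_row b a d c f e B' A' D' C' F' E'
   + C * jacobian_row c a e b f d C' A' E' B' F' D' + D * jacobian_row d a b e f c D' A' B' E' F' C'
   + E * jacobian_row e a c d f b E' A' C' D' F' B' + F * jacobian_row f b c d e a F' B' C' D' E' A'"

lemma edge_cofactor_commute:
  "edge_cofactor x y z y' z' w = edge_cofactor x z y z' y' w"
  "edge_cofactor x y z y' z' w = edge_cofactor x y' z' y z w"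
  "edge_cofactor x y z y' z' w = edge_cofactor x z' y' z y w"
  by (simp_all add: edge_cofactor_def algebra_simps)

lemma face_minor_commute:
  "face_minor x y z = face_minor y x z"
  "face_minor x y z = face_minor x z y"
  by (simp_all add: face_minor_def algebra_simps)

text \<open>For adjacent edges both coefficients are the cofactor of the third edge of their face
  over the minor of that face; for opposite edges both are 1. The relabelled arguments differ by
  symmetries of the tetrahedron, which the two commutation lemmas normalise.\<close>

lemma angle_form_sym: "angle_form c x y = angle_form c y x"
  apply (cases c; cases x; cases y)
  apply (simp add: jacobian_row_def edge_cofactor_commute face_minor_commute)
  apply (simp add: algebra_simps add_divide_distrib)
  done

lemma jacobian_row_linear:
  "jacobian_row x y z y' z' w (X + s*P) (Y + s*Q) (Z + s*R) (Y' + s*S) (Z' + s*T) (W + s*U) =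
   jacobian_row x y z y' z' w X Y Z Y' Z' W + s * jacobian_row x y z y' z' w P Q R S T U"
  by (simp add: jacobian_row_def algebra_simps add_divide_distrib diff_divide_distrib)

lemma linear_angle_form: "linear (angle_form c x)"
proof (rule linearI)
  fix y z :: six and s :: real
  have *: "angle_form c x (y + s *\<^sub>R z) = angle_form c x y + s * angle_form c x z" for y z s
    by (cases c; cases x; cases y; cases z) (simp add: jacobian_row_linear, simp add: algebra_simps)
  show "angle_form c x (y + z) = angle_form c x y + angle_form c x z" using *[of y 1 z] by simp
  have "angle_form c x 0 = 0" using *[of 0 1 0] by simp
  then show "angle_form c x (s *\<^sub>R z) = s *\<^sub>R angle_form c x z" using *[of 0 s z] by simp
qed

text \<open>If all rows vanish on a variation, each off-diagonal cofactor changes at the mean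
  relative rate of two diagonal ones. The adjugate then varies by a diagonal rescaling, and
  \<open>conformal_variation_zero\<close> applies.\<close>

lemma jacobian_row_nondeg:
  assumes dom: "gram_domain (a, b, c, d, e, f)"
    and z: "jacobian_row a b d c e f A B D C E F = 0" "jacobian_row b a d c f e B A D C F E = 0"
     "jacobian_row c a e b f d C A E B F D = 0" "jacobian_row d a b e f c D A B E F C = 0"
     "jacobian_row e a c d f b E A C D F B = 0" "jacobian_row f b c d e a F B C D E A = 0"
  shows "A = 0 \<and> B = 0 \<and> C = 0 \<and> D = 0 \<and> E = 0 \<and> F = 0"
proof -
  have gt: "1 < a" "1 < b" "1 < c" "1 < d" "1 < e" "1 < f" and neg: "gram_det a b c d e f \<noteq> 0"
    using dom by auto
  have sq: "a^2 \<noteq> 1" "b^2 \<noteq> 1" "c^2 \<noteq> 1" "d^2 \<noteq> 1" "e^2 \<noteq> 1" "f^2 \<noteq> 1"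
    using gt by (auto simp: power2_eq_1_iff)
  have m: "face_minor a b d \<noteq> 0" "face_minor a c e \<noteq> 0" "face_minor b c f \<noteq> 0" "face_minor d e f \<noteq> 0"
    using face_minor_pos[of a b d] face_minor_pos[of a c e] face_minor_pos[of b c f] face_minor_pos[of d e f] gt by auto
  \<comment> \<open>The rescaling factors: half the logarithmic derivative of the minor of the face
    opposite each corner. The face opposite corner 0 has the edges \<open>d, e, f\<close>.\<close>
  define m0 where "m0 = face_minor_deriv d e f D E F / (2 * face_minor d e f)"
  define m1 where "m1 = face_minor_deriv b c f B C F / (2 * face_minor b c f)"
  define m2 where "m2 = face_minor_deriv a c e A C E / (2 * face_minor a c e)"
  define m3 where "m3 = face_minor_deriv a b d A B D / (2 * face_minor a b d)"
  have dm: "face_minor_deriv d e f D E F = face_minor d e f * (m0 + m0)" "face_minor_deriv b c f B C F = face_minor b c f * (m1 + m1)"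
     "face_minor_deriv a c e A C E = face_minor a c e * (m2 + m2)" "face_minor_deriv a b d A B D = face_minor a b d * (m3 + m3)"
    using m by (auto simp: m0_def m1_def m2_def m3_def)
  have mm: "face_minor_deriv b a d B A D / (2 * face_minor b a d) = m3" "face_minor_deriv c a e C A E / (2 * face_minor c a e) = m2"
     "face_minor_deriv c b f C B F / (2 * face_minor c b f) = m1" "face_minor_deriv d a b D A B / (2 * face_minor d a b) = m3"
     "face_minor_deriv e a c E A C / (2 * face_minor e a c) = m2" "face_minor_deriv e d f E D F / (2 * face_minor e d f) = m0"
     "face_minor_deriv f b c F B C / (2 * face_minor f b c) = m1" "face_minor_deriv f d e F D E / (2 * face_minor f d e) = m0"
    unfolding m0_def m1_def m2_def m3_def face_minor_deriv_def face_minor_def by (simp_all add: algebra_simps)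
  have nz: "face_minor b a d \<noteq> 0" "face_minor c a e \<noteq> 0" "face_minor c b f \<noteq> 0" "face_minor d a b \<noteq> 0"
     "face_minor e a c \<noteq> 0" "face_minor e d f \<noteq> 0" "face_minor f b c \<noteq> 0" "face_minor f d e \<noteq> 0"
    using face_minor_pos gt by (metis less_irrefl)+
  have dn: "edge_cofactor_deriv a b d c e f A B D C E F = edge_cofactor a b d c e f * (m2 + m3)"
     "edge_cofactor_deriv b a d c f e B A D C F E = edge_cofactor b a d c f e * (m1 + m3)"
     "edge_cofactor_deriv c a e b f d C A E B F D = edge_cofactor c a e b f d * (m1 + m2)"
     "edge_cofactor_deriv d a b e f c D A B E F C = edge_cofactor d a b e f c * (m0 + m3)"
     "edge_cofactor_deriv e a c d f b E A C D F B = edge_cofactor e a c d f b * (m0 + m2)"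
     "edge_cofactor_deriv f b c d e a F B C D E A = edge_cofactor f b c d e a * (m0 + m1)"
    using jacobian_row_eq[OF sq(1) m(1,2), of f A B D C E F] z(1)
      jacobian_row_eq[OF sq(2) nz(1) m(3), of e B A D C F E] z(2)
      jacobian_row_eq[OF sq(3) nz(2,3), of d C A E B F D] z(3)
      jacobian_row_eq[OF sq(4) nz(4) m(4), of c D A B E F C] z(4)
      jacobian_row_eq[OF sq(5) nz(5,6), of b E A C D F B] z(5)
      jacobian_row_eq[OF sq(6) nz(7,8), of a F B C D E A] z(6)
    unfolding mm m0_def[symmetric] m1_def[symmetric] m2_def[symmetric] m3_def[symmetric]
    by (simp_all add: algebra_simps)
  define dG where "dG = sym_matrix 0 0 0 0 (-A) (-B) (-C) (-D) (-E) (-F)"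
  define dA where "dA = sym_matrix (- face_minor_deriv d e f D E F) (- face_minor_deriv b c f B C F) (- face_minor_deriv a c e A C E) (- face_minor_deriv a b d A B D)
     (edge_cofactor_deriv f b c d e a F B C D E A) (edge_cofactor_deriv e a c d f b E A C D F B) (edge_cofactor_deriv d a b e f c D A B E F C)
     (edge_cofactor_deriv c a e b f d C A E B F D) (edge_cofactor_deriv b a d c f e B A D C F E) (edge_cofactor_deriv a b d c e f A B D C E F)"
  have "dG ** pole_adj a b c d e f + pole_gram a b c d e f ** dA = gram_det_deriv a b c d e f A B C D E F *\<^sub>R mat 1"
  proof -
    have "pole_gram A B C D E F = mat 1 + dG"
      unfolding pole_gram_def dG_def mat_def sym_matrix_def vec_eq_iff forall_corners by simp
    then have "pole_gram A B C D E F ** pole_adj a b c d e f - pole_adj a b c d e f = dG ** pole_adj a b c d e f"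
      by (simp add: matrix_add_rdistrib)
    then show ?thesis using pole_gram_pole_adj_deriv[of A B C D E F a b c d e f] unfolding dA_def by simp
  qed
  moreover have "dA $ i $ j = pole_adj a b c d e f $ i $ j * (at_corner i m0 m1 m2 m3 + at_corner j m0 m1 m2 m3)" for i j
  proof -
    have "\<forall>i j. dA $ i $ j = pole_adj a b c d e f $ i $ j * (at_corner i m0 m1 m2 m3 + at_corner j m0 m1 m2 m3)"
      unfolding forall_corners dA_def pole_adj_def sym_matrix_def dn dm by simp
    then show ?thesis by blast
  qed
  moreover have "pole_gram a b c d e f $ i $ i = 1" "dG $ i $ i = 0" for i
  proof -
    have "\<forall>i. pole_gram a b c d e f $ i $ i = 1 \<and> dG $ i $ i = 0"
      unfolding forall_corners pole_gram_def dG_def sym_matrix_def by simp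
    then show "pole_gram a b c d e f $ i $ i = 1" "dG $ i $ i = 0" by blast+
  qed
  ultimately have "dG = 0"
    by (intro conformal_variation_zero[OF pole_gram_pole_adj, where \<mu> = "\<lambda>i. at_corner i m0 m1 m2 m3"]) (use neg in auto)
  then show ?thesis
    unfolding vec_eq_iff forall_corners dG_def sym_matrix_def by simp
qed

lemma angle_form_nondeg:
  assumes "gram_domain c" "x \<noteq> 0"
  shows "\<exists>y. angle_form c y x \<noteq> 0"
proof (rule ccontr)
  assume "\<not> ?thesis"
  then have z: "angle_form c y x = 0" for y by blast
  obtain a b d e f g where c: "c = (a, b, d, e, f, g)" by (metis prod.exhaust)
  obtain A B D E F G where x: "x = (A, B, D, E, F, G)" by (metis prod.exhaust)
  have "A = 0 \<and> B = 0 \<and> D = 0 \<and> E = 0 \<and> F = 0 \<and> G = 0"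
    using z[of "(1,0,0,0,0,0)"] z[of "(0,1,0,0,0,0)"] z[of "(0,0,1,0,0,0)"]
       z[of "(0,0,0,1,0,0)"] z[of "(0,0,0,0,1,0)"] z[of "(0,0,0,0,0,1)"]
    unfolding c x by (intro jacobian_row_nondeg[OF assms(1)[unfolded c]]) auto
  then show False using assms(2) x by (simp add: zero_prod_def)
qed

text \<open>At cosine 2 the matrix has 8/3 on the diagonal, -2/3 between adjacent edges and 1
  between opposite ones. Hence sums such as \<open>A + F\<close> and differences such as
  \<open>A - F\<close> over opposite edges separate, and the form is a sum of squares.\<close>

lemma angle_form_regular:
  assumes "x \<noteq> 0"
  shows "angle_form (2, 2, 2, 2, 2, 2) x x > 0"
proof -
  obtain A B C D E F where x: "x = (A, B, C, D, E, F)" by (metis prod.exhaust)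
  have *: "6 * angle_form (2, 2, 2, 2, 2, 2) x x =
     5 * ((A - F)^2 + (B - E)^2 + (C - D)^2) + 3 * ((A + F)^2 + (B + E)^2 + (C + D)^2)
     + 4 * (((A + F) - (B + E))^2 + ((A + F) - (C + D))^2 + ((B + E) - (C + D))^2)"
    unfolding x by (simp add: jacobian_row_def jacobian_diag_def edge_cofactor_def face_minor_def power2_eq_square, simp add: field_simps)
  have "6 * angle_form (2, 2, 2, 2, 2, 2) x x \<ge> 6 * (A^2 + B^2 + C^2 + D^2 + E^2 + F^2)"
  proof -
    have "5 * ((A - F)^2 + (B - E)^2 + (C - D)^2) + 3 * ((A + F)^2 + (B + E)^2 + (C + D)^2)
      = 6 * (A^2 + B^2 + C^2 + D^2 + E^2 + F^2) + 2 * ((A - F)^2 + (B - E)^2 + (C - D)^2)"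
      by (simp add: power2_eq_square algebra_simps)
    moreover have "0 \<le> (A - F)^2 + (B - E)^2 + (C - D)^2"
      "0 \<le> ((A + F) - (B + E))^2 + ((A + F) - (C + D))^2 + ((B + E) - (C + D))^2" by simp_all
    moreover have "6 * u \<le> 5 * p + 3 * q + 4 * r"
      if "5 * p + 3 * q = 6 * u + 2 * p" "0 \<le> p" "0 \<le> r" for p q r u :: real
      using that by linarith
    ultimately show ?thesis unfolding * by blast
  qed
  moreover have "A^2 + B^2 + C^2 + D^2 + E^2 + F^2 > 0"
  proof -
    have "A \<noteq> 0 \<or> B \<noteq> 0 \<or> C \<noteq> 0 \<or> D \<noteq> 0 \<or> E \<noteq> 0 \<or> F \<noteq> 0" using assms x by (auto simp: zero_prod_def)
    moreover have "A^2 \<ge> 0" "B^2 \<ge> 0" "C^2 \<ge> 0" "D^2 \<ge> 0" "E^2 \<ge> 0" "F^2 \<ge> 0" by auto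
    ultimately show ?thesis by (smt (verit) zero_less_power2)
  qed
  moreover have "0 < T" if "6 * u \<le> 6 * T" "0 < u" for T u :: real using that by linarith
  ultimately show ?thesis by blast
qed

section \<open>Positive definiteness\<close>

text \<open>A nondegenerate positive semidefinite form is definite, so a parameter where
  definiteness fails already has a strictly negative value. The set \<open>N\<close> of these
  parameters is therefore closed and open in the unit interval, and it misses 1.\<close>

lemma pos_def_along_path:
  fixes B :: "real \<Rightarrow> 'a::euclidean_space \<Rightarrow> 'a \<Rightarrow> real"
  assumes lin: "\<And>t x. linear (B t x)"
    and sym: "\<And>t x y. B t x y = B t y x"
    and cont: "continuous_on ({0..1} \<times> UNIV) (\<lambda>p. B (fst p) (snd p) (snd p))"
    and nondeg: "\<And>t x. t \<in> {0..1} \<Longrightarrow> x \<noteq> 0 \<Longrightarrow> \<exists>y. B t y x \<noteq> 0"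
    and base: "\<And>x. x \<noteq> 0 \<Longrightarrow> B 1 x x > 0"
    and x: "x \<noteq> 0"
  shows "B 0 x x > 0"
proof -
  define N where "N = {t\<in>{0..1}. \<exists>x\<in>sphere 0 1. B t x x \<le> 0}"
  have scale: "B t (s *\<^sub>R y) (s *\<^sub>R y) = s^2 * B t y y" for t s y
    using linear_scale[OF lin, of t "s *\<^sub>R y" s y] linear_scale[OF lin, of t y s y] sym[of t "s *\<^sub>R y" y]
    by (simp add: power2_eq_square)
  have unit: "y /\<^sub>R norm y \<in> sphere 0 1" "B t (y /\<^sub>R norm y) (y /\<^sub>R norm y) = B t y y / (norm y)^2"
    if "y \<noteq> 0" for t y
    using that scale[of t "inverse (norm y)" y] by (auto simp: field_simps)
  have nonneg: "\<exists>y. B t y y < 0" if t: "t \<in> N" for t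
  proof (rule ccontr)
    assume "\<not> ?thesis"
    then have psd: "B t y y \<ge> 0" for y by (meson not_le)
    obtain z where z: "norm z = 1" "B t z z \<le> 0" using t by (auto simp: N_def)
    then have z0: "z \<noteq> 0" "B t z z = 0" using psd[of z] by auto
    have t01: "t \<in> {0..1}" using t by (simp add: N_def)
    obtain y where y: "B t y z \<noteq> 0" using nondeg[OF t01 z0(1)] by blast
    have ex: "B t (y + s *\<^sub>R z) (y + s *\<^sub>R z) = B t y y + 2 * s * B t y z" for s
    proof -
      have "B t (y + s *\<^sub>R z) (y + s *\<^sub>R z) = B t (y + s *\<^sub>R z) y + s * B t (y + s *\<^sub>R z) z"
        using linear_add[OF lin] linear_scale[OF lin] by simp
      also have "\<dots> = B t y (y + s *\<^sub>R z) + s * B t z (y + s *\<^sub>R z)" by (simp only: sym)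
      also have "\<dots> = B t y y + s * B t y z + s * (B t z y + s * B t z z)"
        using linear_add[OF lin] linear_scale[OF lin] by simp
      finally show ?thesis using z0 sym[of t z y] by simp
    qed
    have "B t y y + 2 * s * B t y z \<ge> 0" for s using psd[of "y + s *\<^sub>R z"] ex by simp
    \<comment> \<open>This multiple of the null vector \<open>z\<close> makes the value -1.\<close>
    from this[of "- (B t y y + 1) / (2 * B t y z)"] show False using y by (simp add: field_simps)
  qed
  \<comment> \<open>\<open>N\<close> is the projection of this set to the parameter, so its
    compactness makes \<open>N\<close> closed.\<close>
  have "compact ({p \<in> {0..1} \<times> sphere 0 1. B (fst p) (snd p) (snd p) \<le> 0} :: (real \<times> 'a) set)"
  proof -
    have "closed ({p \<in> {0..1} \<times> sphere 0 1. B (fst p) (snd p) (snd p) \<le> 0} :: (real \<times> 'a) set)"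
      by (intro continuous_on_closed_Collect_le continuous_intros continuous_on_subset[OF cont]
           compact_imp_closed compact_Times compact_sphere) (auto simp: closed_Times)
    then show ?thesis
      unfolding compact_eq_bounded_closed
      by (auto intro!: bounded_subset[OF compact_imp_bounded[OF compact_Times[OF compact_Icc compact_sphere]],
            of _ 0 1 "0::'a" 1])
  qed
  then have "closed N"
  proof -
    assume "compact ({p \<in> {0..1} \<times> sphere 0 1. B (fst p) (snd p) (snd p) \<le> 0} :: (real \<times> 'a) set)"
    then have "compact (fst ` ({p \<in> {0..1} \<times> sphere 0 1. B (fst p) (snd p) (snd p) \<le> 0} :: (real \<times> 'a) set))"
      by (intro compact_continuous_image continuous_intros)
    moreover have "fst ` {p \<in> {0..1} \<times> sphere 0 1. B (fst p) (snd p) (snd p) \<le> 0} = N"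
      unfolding N_def by force
    ultimately show ?thesis using compact_imp_closed by metis
  qed
  then have cl: "closedin (top_of_set {0..1}) N" by (auto intro!: closed_subset simp: N_def)
  \<comment> \<open>\<open>nonneg\<close> replaces the closed condition in \<open>N\<close> by a
    strict one, which is open in \<open>t\<close> for each fixed vector.\<close>
  have Neq: "N = (\<Union>y. {t\<in>{0..1}. B t y y < 0})"
  proof (intro equalityI subsetI)
    fix t assume "t \<in> N"
    then show "t \<in> (\<Union>y. {t\<in>{0..1}. B t y y < 0})" using nonneg[of t] by (auto simp: N_def)
  next
    fix t assume "t \<in> (\<Union>y. {t\<in>{0..1}. B t y y < 0})"
    then obtain y where y: "t \<in> {0..1}" "B t y y < 0" by auto
    then have "y \<noteq> 0" using linear_0[OF lin] by force
    then have "B t (y /\<^sub>R norm y) (y /\<^sub>R norm y) \<le> 0" using y unit(2)[of y t] by (simp add: divide_le_0_iff)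
    then show "t \<in> N" using unit(1)[OF \<open>y \<noteq> 0\<close>] y unfolding N_def by blast
  qed
  have "openin (top_of_set {0..1}) {t\<in>{0..1}. B t y y < 0}" for y
  proof -
    have "continuous_on {0..1} (\<lambda>t. B t y y)"
      using continuous_on_compose2[OF cont, of "{0..1}" "\<lambda>t. (t, y)"]
      by (simp add: image_subset_iff continuous_on_Pair)
    from continuous_openin_preimage_gen[OF this open_lessThan[of 0]] show ?thesis
      by (simp add: vimage_def Int_def)
  qed
  then have "openin (top_of_set {0..1}) N" unfolding Neq by blast
  with cl have "N = {} \<or> N = {0..1}" using connected_clopen[of "{0..1::real}"] connected_Icc by blast
  moreover have "1 \<notin> N" proof
    assume "1 \<in> N"
    then obtain y where "norm y = 1" "B 1 y y \<le> 0" by (auto simp: N_def)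
    then show False using base[of y] by force
  qed
  ultimately have "N = {}" by auto
  moreover have "0 \<in> N" if "B 0 x x \<le> 0"
    using that unit(1)[OF x] unit(2)[OF x, of 0] by (auto simp: N_def divide_le_0_iff intro!: bexI[of _ "x /\<^sub>R norm x"])
  ultimately show ?thesis by force
qed

section \<open>The domain in terms of a vertex triangle\<close>

text \<open>Eliminating the pole of corner 0 leaves a Schur complement which, up to sign, has
  diagonal \<open>a^2 - 1\<close>, \<open>b^2 - 1\<close>, \<open>c^2 - 1\<close> and off-diagonal
  entries \<open>d + a*b\<close>, \<open>e + a*c\<close>, \<open>f + b*c\<close>. The right side is
  the determinant of that matrix.\<close>

lemma gram_det_link:
  "- gram_det a b c d e f = (a^2 - 1) * (b^2 - 1) * (c^2 - 1) + 2 * (d + a*b) * (e + a*c) * (f + b*c)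
     - (d + a*b)^2 * (c^2 - 1) - (e + a*c)^2 * (b^2 - 1) - (f + b*c)^2 * (a^2 - 1)"
  unfolding gram_det_def by algebra

text \<open>Scaling rows and columns normalises the diagonal of the Schur complement to 1. By the
  hexagonal cosine law \<open>P, Q, R\<close> are then the hyperbolic cosines of the sides of the
  vertex triangle.\<close>

lemma gram_det_link_scaled:
  fixes s1 s2 s3 :: real
  assumes s: "s1^2 * (a^2 - 1) = 1" "s2^2 * (b^2 - 1) = 1" "s3^2 * (c^2 - 1) = 1"
    and P: "P = s1 * s2 * (d + a*b)" and Q: "Q = s1 * s3 * (e + a*c)" and R: "R = s2 * s3 * (f + b*c)"
  shows "(s1 * s2 * s3)^2 * (- gram_det a b c d e f) = 1 + 2*P*Q*R - P^2 - Q^2 - R^2"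
proof -
  have "(s1 * s2 * s3)^2 * (- gram_det a b c d e f) = (s1^2 * (a^2 - 1)) * (s2^2 * (b^2 - 1)) * (s3^2 * (c^2 - 1))
    + 2*P*Q*R - P^2 * (s3^2 * (c^2 - 1)) - Q^2 * (s2^2 * (b^2 - 1)) - R^2 * (s1^2 * (a^2 - 1))"
    unfolding gram_det_link P Q R by algebra
  then show ?thesis unfolding s by simp
qed

lemma cosh_gram:
  fixes p q r :: real
  shows "1 + 2 * cosh p * cosh q * cosh r - (cosh p)^2 - (cosh q)^2 - (cosh r)^2
    = (cosh (p + q) - cosh r) * (cosh r - cosh (p - q))"
proof -
  have h: "(cosh p)^2 = (sinh p)^2 + 1" "(cosh q)^2 = (sinh q)^2 + 1" by (simp_all add: cosh_square_eq)
  show ?thesis unfolding cosh_add cosh_diff using h by algebra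
qed

lemma cosh_less_iff_abs: "cosh x < cosh (y::real) \<longleftrightarrow> \<bar>x\<bar> < \<bar>y\<bar>"
proof -
  have "cosh \<bar>z\<bar> = cosh z" for z :: real by (simp add: abs_if)
  then show ?thesis using cosh_real_nonneg_less_iff[of "\<bar>x\<bar>" "\<bar>y\<bar>"] by simp
qed

text \<open>In the factorisation \<open>cosh_gram\<close> the factors are positive exactly for
  \<open>r < p + q\<close> and for r greater than the absolute value of \<open>p - q\<close>. They
  cannot both be negative, since that absolute value is at most \<open>p + q\<close>.\<close>

lemma cosh_gram_pos_iff:
  fixes p q r :: real
  assumes "0 \<le> p" "0 \<le> q" "0 \<le> r"
  shows "0 < 1 + 2 * cosh p * cosh q * cosh r - (cosh p)^2 - (cosh q)^2 - (cosh r)^2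
    \<longleftrightarrow> p < q + r \<and> q < p + r \<and> r < p + q"
  unfolding cosh_gram zero_less_mult_iff using assms by (auto simp: cosh_less_iff_abs)

text \<open>Coordinates in which the domain is convex.  Let \<open>p, q, r\<close> be the side lengths of the vertex
  triangle at corner 0 and let \<open>sinh u = 1 / sinh l\<close> for the edge of length \<open>l\<close> from corner 0 to another
  corner.  The hexagonal cosine law gives \<open>link_chart\<close>; positivity of the opposite edge lengths becomes
  \<open>u + v < p\<close>, and negativity of the Gram determinant becomes the triangle inequalities.\<close>

fun link_domain :: "six \<Rightarrow> bool" where
  "link_domain (u, v, w, p, q, r) \<longleftrightarrow> 0 < u \<and> 0 < v \<and> 0 < w \<and> u + v < p \<and> u + w < q \<and> v + w < r
     \<and> p < q + r \<and> q < p + r \<and> r < p + q"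

fun link_chart :: "six \<Rightarrow> six" where
  "link_chart (u, v, w, p, q, r) = (cosh u / sinh u, cosh v / sinh v, cosh w / sinh w,
     (cosh p - cosh u * cosh v) / (sinh u * sinh v),
     (cosh q - cosh u * cosh w) / (sinh u * sinh w),
     (cosh r - cosh v * cosh w) / (sinh v * sinh w))"

lemma gram_domain_link_chart:
  assumes "link_domain P"
  shows "gram_domain (link_chart P)"
proof -
  obtain u v w p q r where P: "P = (u, v, w, p, q, r)" by (metis prod.exhaust)
  have d: "0 < u" "0 < v" "0 < w" "u + v < p" "u + w < q" "v + w < r" "p < q + r" "q < p + r" "r < p + q"
    using assms P by auto
  have coth: "1 < cosh x / sinh x" "(sinh x)^2 * ((cosh x / sinh x)^2 - 1) = 1" if "0 < x" for x :: real
  proof -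
    have "sinh x > 0" using that by simp
    then show "1 < cosh x / sinh x" using sinh_less_cosh_real[of x] by simp
    show "(sinh x)^2 * ((cosh x / sinh x)^2 - 1) = 1"
      using \<open>sinh x > 0\<close> by (simp add: power_divide right_diff_distrib cosh_square_eq)
  qed
  \<comment> \<open>At \<open>z = x + y\<close> the quotient is exactly 1 by the addition
    formula.\<close>
  have side: "1 < (cosh z - cosh x * cosh y) / (sinh x * sinh y)" if "0 < x" "0 < y" "x + y < z" for x y z :: real
  proof -
    have "cosh (x + y) < cosh z" using that by (simp add: cosh_less_iff_abs)
    moreover have "sinh x * sinh y > 0" using that by simp
    ultimately show ?thesis by (simp add: cosh_add)
  qed
  have sd: "cosh z = sinh x * sinh y * ((cosh z - cosh x * cosh y) / (sinh x * sinh y) + cosh x / sinh x * (cosh y / sinh y))"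
    if "0 < x" "0 < y" for x y z :: real
  proof -
    have "sinh x \<noteq> 0" "sinh y \<noteq> 0" using that by auto
    then show ?thesis by (simp add: field_simps)
  qed
  have "0 < 1 + 2 * cosh p * cosh q * cosh r - (cosh p)^2 - (cosh q)^2 - (cosh r)^2"
    using d by (subst cosh_gram_pos_iff) auto
  then have "0 < (sinh u * sinh v * sinh w)^2 * (- gram_det (cosh u / sinh u) (cosh v / sinh v) (cosh w / sinh w)
     ((cosh p - cosh u * cosh v) / (sinh u * sinh v)) ((cosh q - cosh u * cosh w) / (sinh u * sinh w))
     ((cosh r - cosh v * cosh w) / (sinh v * sinh w)))"
    using gram_det_link_scaled[OF coth(2)[OF d(1)] coth(2)[OF d(2)] coth(2)[OF d(3)] sd[OF d(1,2)] sd[OF d(1,3)] sd[OF d(2,3)]]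
    by simp
  then have "gram_det (cosh u / sinh u) (cosh v / sinh v) (cosh w / sinh w)
     ((cosh p - cosh u * cosh v) / (sinh u * sinh v)) ((cosh q - cosh u * cosh w) / (sinh u * sinh w))
     ((cosh r - cosh v * cosh w) / (sinh v * sinh w)) < 0"
    by (metis neg_0_less_iff_less not_less zero_le_power2 zero_less_mult_iff)
  then show ?thesis unfolding P using coth(1) side d by simp
qed

text \<open>The chart is inverted explicitly: \<open>u\<close> is the arsinh of
  \<open>1 / sinh l\<close>, and the sides are the arcosh of the hexagonal cosine law. An opposite
  edge cosine above 1 makes that value exceed \<open>cosh (u + v)\<close>, so arcosh applies and
  \<open>u + v < p\<close>.\<close>

lemma link_chart_surj:
  assumes "gram_domain c"
  shows "\<exists>P. link_domain P \<and> link_chart P = c"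
proof -
  obtain a b c' d e f where c: "c = (a, b, c', d, e, f)" by (metis prod.exhaust)
  have gt: "1 < a" "1 < b" "1 < c'" "1 < d" "1 < e" "1 < f" and neg: "gram_det a b c' d e f < 0"
    using assms c by auto
  have ex: "\<exists>u>0. cosh u = x * sinh u \<and> (sinh u)^2 * (x^2 - 1) = 1" if "1 < x" for x :: real
  proof (intro exI conjI)
    define s where "s = 1 / sqrt (x^2 - 1)"
    have x2: "x^2 - 1 > 0" using that by simp
    then have s: "s > 0" "s^2 * (x^2 - 1) = 1" by (auto simp: s_def power_divide)
    have sh: "sinh (arsinh s) = s" by simp
    show "0 < arsinh s" using s(1) sh by (metis sinh_real_pos_iff)
    have "(cosh (arsinh s))^2 = (x * s)^2" using s(2) by (simp add: cosh_square_eq power_mult_distrib algebra_simps)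
    moreover have "0 \<le> x * s" using that s by simp
    ultimately show "cosh (arsinh s) = x * sinh (arsinh s)" unfolding sh
      using power2_eq_imp_eq cosh_real_nonneg by blast
    show "(sinh (arsinh s))^2 * (x^2 - 1) = 1" unfolding sh using s by simp
  qed
  obtain u where u: "u > 0" "cosh u = a * sinh u" "(sinh u)^2 * (a^2 - 1) = 1" using ex gt by blast
  obtain v where v: "v > 0" "cosh v = b * sinh v" "(sinh v)^2 * (b^2 - 1) = 1" using ex gt by blast
  obtain w where w: "w > 0" "cosh w = c' * sinh w" "(sinh w)^2 * (c'^2 - 1) = 1" using ex gt by blast
  have side: "\<exists>z. x + y < z \<and> cosh z = sinh x * sinh y * (k + i * j)"
    if "0 < x" "0 < y" "cosh x = i * sinh x" "cosh y = j * sinh y" "1 < k" for x y i j k :: real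
  proof -
    have sp: "sinh x * sinh y > 0" using that by simp
    have "cosh (x + y) = sinh x * sinh y * (1 + i * j)" by (simp add: cosh_add that algebra_simps)
    also have "\<dots> < sinh x * sinh y * (k + i * j)" using sp that by simp
    finally have lt: "cosh (x + y) < sinh x * sinh y * (k + i * j)" .
    then have ge: "1 \<le> sinh x * sinh y * (k + i * j)" using cosh_real_ge_1[of "x + y"] by linarith
    then have "cosh (arcosh (sinh x * sinh y * (k + i * j))) = sinh x * sinh y * (k + i * j)"
      by (rule cosh_arcosh_real)
    moreover have "arcosh (sinh x * sinh y * (k + i * j)) \<ge> 0" using ge by (rule arcosh_nonneg_real)
    ultimately show ?thesis using lt that
      by (intro exI[of _ "arcosh (sinh x * sinh y * (k + i * j))"]) (metis abs_of_nonneg abs_of_pos add_pos_pos cosh_less_iff_abs)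
  qed
  obtain p where p: "u + v < p" "cosh p = sinh u * sinh v * (d + a * b)" using side u v gt by blast
  obtain q where q: "u + w < q" "cosh q = sinh u * sinh w * (e + a * c')" using side u w gt by blast
  obtain r where r: "v + w < r" "cosh r = sinh v * sinh w * (f + b * c')" using side v w gt by blast
  have nz: "sinh u > 0" "sinh v > 0" "sinh w > 0" using u v w by auto
  have "0 < (sinh u * sinh v * sinh w)^2 * (- gram_det a b c' d e f)"
    using nz neg by (intro mult_pos_pos) auto
  then have "0 < 1 + 2 * cosh p * cosh q * cosh r - (cosh p)^2 - (cosh q)^2 - (cosh r)^2"
    using gram_det_link_scaled[OF u(3) v(3) w(3) p(2) q(2) r(2)] by simp
  then have "p < q + r \<and> q < p + r \<and> r < p + q"
    using p q r u v w by (subst (asm) cosh_gram_pos_iff) auto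
  then have "link_domain (u, v, w, p, q, r)" using u v w p q r by simp
  moreover have "link_chart (u, v, w, p, q, r) = c"
    unfolding c using nz by (simp add: u(2) v(2) w(2) p(2) q(2) r(2) field_simps)
  ultimately show ?thesis by blast
qed

section \<open>Definiteness along a path to the regular tetrahedron\<close>

lemma continuous_on_face_minor:
  assumes "continuous_on S x" "continuous_on S y" "continuous_on S z"
  shows "continuous_on S (\<lambda>p. face_minor (x p) (y p) (z p))"
  unfolding face_minor_def by (intro continuous_intros assms)

lemma continuous_on_edge_cofactor:
  assumes "continuous_on S x" "continuous_on S y" "continuous_on S z"
     "continuous_on S y'" "continuous_on S z'" "continuous_on S w"
  shows "continuous_on S (\<lambda>p. edge_cofactor (x p) (y p) (z p) (y' p) (z' p) (w p))"
  unfolding edge_cofactor_def by (intro continuous_intros assms)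

lemma continuous_on_jacobian_row:
  assumes "continuous_on S x" "continuous_on S y" "continuous_on S z"
     "continuous_on S y'" "continuous_on S z'" "continuous_on S w"
     "continuous_on S X" "continuous_on S Y" "continuous_on S Z"
     "continuous_on S Y'" "continuous_on S Z'" "continuous_on S W"
    and gt: "\<And>p. p \<in> S \<Longrightarrow> 1 < x p \<and> 1 < y p \<and> 1 < z p \<and> 1 < y' p \<and> 1 < z' p"
  shows "continuous_on S (\<lambda>p. jacobian_row (x p) (y p) (z p) (y' p) (z' p) (w p) (X p) (Y p) (Z p) (Y' p) (Z' p) (W p))"
proof -
  have "face_minor (x p) (y p) (z p) \<noteq> 0" "face_minor (x p) (y' p) (z' p) \<noteq> 0" "(x p)^2 - 1 \<noteq> 0" if "p \<in> S" for p
    using face_minor_pos[of "x p" "y p" "z p"] face_minor_pos[of "x p" "y' p" "z' p"] gt[OF that]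
    by (auto simp: power2_eq_1_iff)
  then show ?thesis unfolding jacobian_row_def jacobian_diag_def
    by (intro continuous_intros continuous_on_face_minor continuous_on_edge_cofactor assms) auto
qed

lemma continuous_on_angle_form:
  fixes g h :: "'p::topological_space \<Rightarrow> six"
  assumes g: "continuous_on S g" and h: "continuous_on S h" and d: "\<And>p. p \<in> S \<Longrightarrow> gram_domain (g p)"
  shows "continuous_on S (\<lambda>p. angle_form (g p) (h p) (h p))"
proof -
  have e: "x = (fst x, fst (snd x), fst (snd (snd x)), fst (snd (snd (snd x))),
      fst (snd (snd (snd (snd x)))), snd (snd (snd (snd (snd x)))))" for x :: six
    by simp
  have gt: "1 < fst (g p) \<and> 1 < fst (snd (g p)) \<and> 1 < fst (snd (snd (g p))) \<and> 1 < fst (snd (snd (snd (g p)))) \<and>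
      1 < fst (snd (snd (snd (snd (g p))))) \<and> 1 < snd (snd (snd (snd (snd (g p)))))" if "p \<in> S" for p
    using d[OF that] by (subst (asm) e) (simp only: gram_domain.simps)
  have "continuous_on S (\<lambda>p. angle_form
     (fst (g p), fst (snd (g p)), fst (snd (snd (g p))), fst (snd (snd (snd (g p)))),
        fst (snd (snd (snd (snd (g p))))), snd (snd (snd (snd (snd (g p))))))
     (fst (h p), fst (snd (h p)), fst (snd (snd (h p))), fst (snd (snd (snd (h p)))),
        fst (snd (snd (snd (snd (h p))))), snd (snd (snd (snd (snd (h p))))))
     (fst (h p), fst (snd (h p)), fst (snd (snd (h p))), fst (snd (snd (snd (h p)))),
        fst (snd (snd (snd (snd (h p))))), snd (snd (snd (snd (snd (h p)))))))"
    unfolding angle_form.simps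
    by (intro continuous_on_add continuous_on_mult continuous_on_jacobian_row continuous_on_fst continuous_on_snd g h)
      (use gt in auto)
  then show ?thesis by simp
qed

theorem angle_form_pos:
  assumes c: "gram_domain c" and x: "x \<noteq> 0"
  shows "angle_form c x x > 0"
proof -
  obtain P where P: "link_domain P" "link_chart P = c" using link_chart_surj[OF c] by blast
  have "gram_domain (2, 2, 2, 2, 2, 2)" by (simp add: gram_det_def)
  then obtain R where R: "link_domain R" "link_chart R = (2, 2, 2, 2, 2, 2)" using link_chart_surj by blast
  obtain u v w p q r where Pe: "P = (u, v, w, p, q, r)" by (metis prod.exhaust)
  obtain u' v' w' p' q' r' where Re: "R = (u', v', w', p', q', r')" by (metis prod.exhaust)
  \<comment> \<open>All conditions in \<open>link_domain\<close> are strict linear inequalities, so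
    the straight segment in these coordinates stays inside; it runs from \<open>c\<close> at 0 to
    the regular tetrahedron at 1.\<close>
  define g where "g t = link_chart ((1 - t) *\<^sub>R P + t *\<^sub>R R)" for t :: real
  have g01: "g 0 = c" "g 1 = (2, 2, 2, 2, 2, 2)" using P R by (auto simp: g_def)
  have conv: "(1 - t) * x + t * x' < (1 - t) * y + t * y'" if "t \<in> {0..1}" "x < y" "x' < y'" for t x x' y y' :: real
  proof (cases "t = 0")
    case False
    have "(1 - t) * x \<le> (1 - t) * y" using that by (intro mult_left_mono) auto
    moreover have "t * x' < t * y'" using that False by auto
    ultimately show ?thesis by linarith
  qed (use that in auto)
  have pd: "link_domain ((1 - t) *\<^sub>R P + t *\<^sub>R R)" if t: "t \<in> {0..1}" for t
    using P(1) R(1) conv[OF t, of 0 u 0 u'] conv[OF t, of 0 v 0 v'] conv[OF t, of 0 w 0 w']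
      conv[OF t, of "u + v" p "u' + v'" p'] conv[OF t, of "u + w" q "u' + w'" q'] conv[OF t, of "v + w" r "v' + w'" r']
      conv[OF t, of p "q + r" p' "q' + r'"] conv[OF t, of q "p + r" q' "p' + r'"] conv[OF t, of r "p + q" r' "p' + q'"]
    unfolding Pe Re by (simp add: distrib_left)
  have td: "gram_domain (g t)" if "t \<in> {0..1}" for t
    using gram_domain_link_chart[OF pd[OF that]] by (simp add: g_def)
  have cg: "continuous_on {0..1} g"
  proof -
    have pos: "sinh ((1 - t) * u + t * u') \<noteq> 0" "sinh ((1 - t) * v + t * v') \<noteq> 0" "sinh ((1 - t) * w + t * w') \<noteq> 0"
      if "t \<in> {0..1}" for t using pd[OF that] unfolding Pe Re by auto
    show ?thesis
      unfolding g_def Pe Re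
      by (simp, intro continuous_intros) (use pos in auto)
  qed
  have "angle_form (g 0) x x > 0"
  proof (rule pos_def_along_path[where B = "\<lambda>t. angle_form (g t)"])
    show "continuous_on ({0..1} \<times> UNIV) (\<lambda>p. angle_form (g (fst p)) (snd p) (snd p))"
      by (rule continuous_on_angle_form)
        (auto intro!: continuous_on_compose2[OF cg] continuous_intros td)
  qed (use linear_angle_form angle_form_sym angle_form_nondeg td angle_form_regular g01 x in auto)
  then show ?thesis unfolding g01 .
qed

section \<open>Hyper-ideal tetrahedra\<close>

lemma det_pole_gram: "det (pole_gram a b c d e f) = gram_det a b c d e f"
proof -
  have f0: "finite {1::4, 2, 3}" "0 \<notin> {1::4, 2, 3}" and f1: "finite {2::4, 3}" "1 \<notin> {2::4, 3}"
    and f2: "finite {3::4}" "2 \<notin> {3::4}" by auto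
  show ?thesis
    unfolding det_def UNIV_corners
    unfolding sum_over_permutations_insert[OF f0]
    unfolding sum_over_permutations_insert[OF f1]
    unfolding sum_over_permutations_insert[OF f2]
    unfolding permutes_sing
    by (simp add: sign_swap_id permutation_swap_id sign_compose sign_id swap_id_eq permutation_compose
         pole_gram_def sym_matrix_def gram_det_def transpose_def, simp add: algebra_simps power2_eq_square)
qed

lemma matrix_inv_eqI:
  fixes A B :: "real^'n^'n"
  assumes "A ** B = mat 1" "B ** A = mat 1"
  shows "matrix_inv A = B"
proof -
  have "A ** matrix_inv A = mat 1 \<and> matrix_inv A ** A = mat 1"
    unfolding matrix_inv_def by (rule someI[of _ B]) (use assms in auto)
  then have "matrix_inv A = matrix_inv A ** (A ** B)" "matrix_inv A ** A = mat 1" using assms by auto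
  then show ?thesis by (metis matrix_mul_assoc matrix_mul_lid)
qed

definition cosh_edges :: "(4 \<Rightarrow> 4 \<Rightarrow> real) \<Rightarrow> six" where
  "cosh_edges l = (cosh (l 0 1), cosh (l 0 2), cosh (l 0 3), cosh (l 1 2), cosh (l 1 3), cosh (l 2 3))"

lemma gram_eq_pole_gram:
  assumes "\<And>a b. a \<noteq> b \<Longrightarrow> l a b = l b a"
  shows "gram l = pole_gram (cosh (l 0 1)) (cosh (l 0 2)) (cosh (l 0 3)) (cosh (l 1 2)) (cosh (l 1 3)) (cosh (l 2 3))"
  unfolding vec_eq_iff forall_corners gram_def pole_gram_def sym_matrix_def
  using assms[of 1 0] assms[of 2 0] assms[of 3 0] assms[of 2 1] assms[of 3 1] assms[of 3 2] by simp

text \<open>With \<open>V\<close> the matrix of the poles and \<open>J\<close> the Minkowski form,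
  the Gram matrix is \<open>V ** J ** transpose V\<close>. Its determinant is minus the square of
  \<open>det V\<close>, which is nonzero by independence.\<close>

lemma det_gram_neg:
  assumes inj: "inj v" and ind: "independent (range v)"
    and v1: "\<And>a. mink (v a) (v a) = 1" and v2: "\<And>a b. a \<noteq> b \<Longrightarrow> mink (v a) (v b) = - cosh (l a b)"
  shows "det (gram l) < 0"
proof -
  define V :: "real^4^4" where "V = (\<chi> a. v a)"
  define J :: "real^4^4" where "J = sym_matrix (-1) 1 1 1 0 0 0 0 0 0"
  have "gram l = V ** J ** transpose V"
  proof -
    have "gram l $ a $ b = mink (v a) (v b)" for a b
      using v1 v2 by (simp add: gram_def)
    moreover have "(V ** J ** transpose V) $ a $ b = mink (v a) (v b)" for a b
      unfolding mink_def matrix_matrix_mult_def sum_corners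
      by (simp add: V_def J_def sym_matrix_def transpose_def)
    ultimately show ?thesis by (simp add: vec_eq_iff)
  qed
  moreover have "det J = -1"
  proof -
    have "J = (\<chi> i j. if i = j then at_corner i (-1) 1 1 1 else 0)"
      unfolding J_def sym_matrix_def vec_eq_iff forall_corners by simp
    moreover have "det (\<chi> i j. if i = j then at_corner i (-1) 1 1 1 else 0 :: real^4^4) = (\<Prod>i\<in>UNIV. at_corner i (-1) 1 1 1)"
      by (subst det_diagonal) auto
    ultimately show ?thesis unfolding UNIV_corners by simp
  qed
  moreover have "det V \<noteq> 0"
  proof -
    have "(\<forall>i. c i = 0)" if "(\<Sum>i\<in>UNIV. c i *s row i V) = 0" for c :: "4 \<Rightarrow> real"
    proof -
      have "(\<Sum>x\<in>range v. c (inv v x) *\<^sub>R x) = (\<Sum>i\<in>UNIV. c i *\<^sub>R v i)"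
        by (subst sum.reindex[OF inj]) (simp add: inj)
      also have "\<dots> = 0" using that by (simp add: V_def row_def scalar_mult_eq_scaleR)
      finally have "c (inv v x) = 0" if "x \<in> range v" for x
        using independentD[OF ind _ subset_refl _ that] by simp
      then show ?thesis using inj by (metis inv_f_f rangeI)
    qed
    then have "invertible V"
      unfolding invertible_right_inverse matrix_right_invertible_independent_rows by blast
    then show ?thesis using invertible_det_nz by blast
  qed
  moreover from this have "0 < det V * det V" using not_real_square_gt_zero by blast
  ultimately show ?thesis by (simp add: det_mul)
qed

lemma hyperideal_gram_domain:
  assumes "hyperideal_tet l"
  shows "gram_domain (cosh_edges l)"
proof -
  have s: "\<And>a b. a \<noteq> b \<Longrightarrow> l a b > 0 \<and> l a b = l b a" using assms by (auto simp: hyperideal_tet_def)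
  obtain v :: "4 \<Rightarrow> real^4" where v: "inj v" "independent (range v)" "\<forall>a. mink (v a) (v a) = 1"
      "\<forall>a b. a \<noteq> b \<longrightarrow> mink (v a) (v b) = - cosh (l a b)"
    using assms unfolding hyperideal_tet_def by auto
  have "det (gram l) < 0" by (rule det_gram_neg[OF v(1,2)]) (use v in auto)
  then have "gram_det (cosh (l 0 1)) (cosh (l 0 2)) (cosh (l 0 3)) (cosh (l 1 2)) (cosh (l 1 3)) (cosh (l 2 3)) < 0"
    by (subst (asm) gram_eq_pole_gram) (use s in \<open>auto simp: det_pole_gram\<close>)
  moreover have "1 < cosh x" if "x > 0" for x :: real
    using that cosh_real_nonneg_less_iff[of 0 x] by simp
  ultimately show ?thesis using s unfolding cosh_edges_def by simp
qed

text \<open>The definite description in \<open>dihedral\<close> leaves the order of \<open>k\<close>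
  and \<open>h\<close> open; symmetry of the inverse Gram matrix makes both orders give the same
  angle.\<close>

lemma dihedral_eqI:
  assumes kh: "k \<noteq> h" "{k, h} = UNIV - {a, b}"
    and H: "matrix_inv (gram l) = H" and sym: "H $ k $ h = H $ h $ k"
  shows "dihedral l a b = arccos (- H $ k $ h / sqrt (H $ k $ k * H $ h $ h))"
  unfolding dihedral_def H
proof (rule the_equality)
  show "\<exists>k' h'. k' \<noteq> h' \<and> {k', h'} = UNIV - {a, b} \<and>
      arccos (- H $ k $ h / sqrt (H $ k $ k * H $ h $ h)) = arccos (- H $ k' $ h' / sqrt (H $ k' $ k' * H $ h' $ h'))"
    using kh by blast
next
  fix \<theta> assume "\<exists>k' h'. k' \<noteq> h' \<and> {k', h'} = UNIV - {a, b} \<and> \<theta> = arccos (- H $ k' $ h' / sqrt (H $ k' $ k' * H $ h' $ h'))"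
  then obtain k' h' where "{k', h'} = {k, h}" "\<theta> = arccos (- H $ k' $ h' / sqrt (H $ k' $ k' * H $ h' $ h'))"
    using kh by auto
  then show "\<theta> = arccos (- H $ k $ h / sqrt (H $ k $ k * H $ h $ h))"
    using sym by (auto simp: doubleton_eq_iff mult.commute)
qed

fun angles :: "six \<Rightarrow> six" where
  "angles (a, b, c, d, e, f) = (dihedral_angle a b d c e f, dihedral_angle b a d c f e, dihedral_angle c a e b f d,
     dihedral_angle d a b e f c, dihedral_angle e a c d f b, dihedral_angle f b c d e a)"

definition edge_tuple :: "(4 \<Rightarrow> 4 \<Rightarrow> 'a) \<Rightarrow> 'a \<times> 'a \<times> 'a \<times> 'a \<times> 'a \<times> 'a" where
  "edge_tuple l = (l 0 1, l 0 2, l 0 3, l 1 2, l 1 3, l 2 3)"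

lemma dihedral_eq_angles:
  assumes "hyperideal_tet l"
  shows "edge_tuple (dihedral l) = angles (cosh_edges l)"
proof -
  have s: "\<And>a b. a \<noteq> b \<Longrightarrow> l a b = l b a" using assms by (auto simp: hyperideal_tet_def)
  define a b c d e f where "a = cosh (l 0 1)" "b = cosh (l 0 2)" "c = cosh (l 0 3)"
     "d = cosh (l 1 2)" "e = cosh (l 1 3)" "f = cosh (l 2 3)"
  note defs = this
  define D where "D = gram_det a b c d e f"
  have neg: "D < 0" using hyperideal_gram_domain[OF assms] by (simp add: cosh_edges_def defs D_def)
  define H where "H = (1 / D) *\<^sub>R pole_adj a b c d e f"
  have "matrix_inv (pole_gram a b c d e f) = H"
    using neg pole_gram_pole_adj[of a b c d e f] unfolding H_def D_def[symmetric]
    by (intro matrix_inv_eqI) (auto simp: matrix_scalar_ac scalar_matrix_assoc[symmetric])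
  then have H: "matrix_inv (gram l) = H" using gram_eq_pole_gram[of l, OF s] by (simp add: defs)
  \<comment> \<open>As \<open>D\<close> is negative, taking it out of the root gives
    \<open>- D\<close>, which absorbs the minus sign in the definition of the dihedral
    angle.\<close>
  have key: "arccos (- (n / D) / sqrt ((m / D) * (m' / D))) = arccos (n / sqrt (m * m'))" for n m m'
  proof -
    have "sqrt ((m / D) * (m' / D)) = sqrt (m * m') / (- D)"
      using neg by (simp add: real_sqrt_divide real_sqrt_mult)
    then show ?thesis using neg by simp
  qed
  have sets: "{2, 3} = UNIV - {0, 1::4}" "{1, 3} = UNIV - {0, 2::4}" "{1, 2} = UNIV - {0, 3::4}"
     "{0, 3} = UNIV - {1, 2::4}" "{0, 2} = UNIV - {1, 3::4}" "{0, 1} = UNIV - {2, 3::4}"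
    unfolding UNIV_corners by auto
  have Hs: "H $ i $ j = pole_adj a b c d e f $ i $ j / D" for i j by (simp add: H_def)
  show ?thesis
    unfolding edge_tuple_def cosh_edges_def angles.simps defs[symmetric]
    using dihedral_eqI[OF _ sets(1) H] dihedral_eqI[OF _ sets(2) H] dihedral_eqI[OF _ sets(3) H]
      dihedral_eqI[OF _ sets(4) H] dihedral_eqI[OF _ sets(5) H] dihedral_eqI[OF _ sets(6) H]
    unfolding Hs key
    by (simp add: pole_adj_def sym_matrix_def dihedral_angle_def face_minor_commute mult.commute)
qed

section \<open>Local monotonicity of the angles in the lengths\<close>

text \<open>The determinant is invariant under relabelling the corners, so all six derivatives share
  the denominator \<open>q\<close>; this lets the rows be assembled into
  \<open>angle_form\<close>.\<close>

lemma angles_deriv: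
  fixes a b c d e f :: "real \<Rightarrow> real"
  assumes D: "(a has_real_derivative A) (at t)" "(b has_real_derivative B) (at t)" "(c has_real_derivative C) (at t)"
    "(d has_real_derivative D) (at t)" "(e has_real_derivative E) (at t)" "(f has_real_derivative F) (at t)"
    and dom: "gram_domain (a t, b t, c t, d t, e t, f t)"
  defines "q \<equiv> sqrt (- gram_det (a t) (b t) (c t) (d t) (e t) (f t))"
  shows "((\<lambda>t. dihedral_angle (a t) (b t) (d t) (c t) (e t) (f t)) has_real_derivative
        sqrt ((a t)^2 - 1) * jacobian_row (a t) (b t) (d t) (c t) (e t) (f t) A B D C E F / q) (at t)"
    "((\<lambda>t. dihedral_angle (b t) (a t) (d t) (c t) (f t) (e t)) has_real_derivative
        sqrt ((b t)^2 - 1) * jacobian_row (b t) (a t) (d t) (c t) (f t) (e t) B A D C F E / q) (at t)"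
    "((\<lambda>t. dihedral_angle (c t) (a t) (e t) (b t) (f t) (d t)) has_real_derivative
        sqrt ((c t)^2 - 1) * jacobian_row (c t) (a t) (e t) (b t) (f t) (d t) C A E B F D / q) (at t)"
    "((\<lambda>t. dihedral_angle (d t) (a t) (b t) (e t) (f t) (c t)) has_real_derivative
        sqrt ((d t)^2 - 1) * jacobian_row (d t) (a t) (b t) (e t) (f t) (c t) D A B E F C / q) (at t)"
    "((\<lambda>t. dihedral_angle (e t) (a t) (c t) (d t) (f t) (b t)) has_real_derivative
        sqrt ((e t)^2 - 1) * jacobian_row (e t) (a t) (c t) (d t) (f t) (b t) E A C D F B / q) (at t)"
    "((\<lambda>t. dihedral_angle (f t) (b t) (c t) (d t) (e t) (a t)) has_real_derivative
        sqrt ((f t)^2 - 1) * jacobian_row (f t) (b t) (c t) (d t) (e t) (a t) F B C D E A / q) (at t)"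
proof -
  have gt: "1 < a t" "1 < b t" "1 < c t" "1 < d t" "1 < e t" "1 < f t"
    and neg: "gram_det (a t) (b t) (c t) (d t) (e t) (f t) < 0" using dom by auto
  have p: "gram_det (b t) (a t) (c t) (d t) (f t) (e t) = gram_det (a t) (b t) (c t) (d t) (e t) (f t)"
    "gram_det (c t) (a t) (b t) (e t) (f t) (d t) = gram_det (a t) (b t) (c t) (d t) (e t) (f t)"
    "gram_det (d t) (a t) (e t) (b t) (f t) (c t) = gram_det (a t) (b t) (c t) (d t) (e t) (f t)"
    "gram_det (e t) (a t) (d t) (c t) (f t) (b t) = gram_det (a t) (b t) (c t) (d t) (e t) (f t)"
    "gram_det (f t) (b t) (d t) (c t) (e t) (a t) = gram_det (a t) (b t) (c t) (d t) (e t) (f t)"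
    unfolding gram_det_def by algebra+
  note n2 = neg[folded p(1)] and n3 = neg[folded p(2)] and n4 = neg[folded p(3)] and n5 = neg[folded p(4)] and n6 = neg[folded p(5)]
  show "((\<lambda>t. dihedral_angle (a t) (b t) (d t) (c t) (e t) (f t)) has_real_derivative
        sqrt ((a t)^2 - 1) * jacobian_row (a t) (b t) (d t) (c t) (e t) (f t) A B D C E F / q) (at t)"
    unfolding q_def by (rule dihedral_angle_deriv; fact)
  show "((\<lambda>t. dihedral_angle (b t) (a t) (d t) (c t) (f t) (e t)) has_real_derivative
        sqrt ((b t)^2 - 1) * jacobian_row (b t) (a t) (d t) (c t) (f t) (e t) B A D C F E / q) (at t)"
    unfolding q_def p(1)[symmetric] by (rule dihedral_angle_deriv; fact)
  show "((\<lambda>t. dihedral_angle (c t) (a t) (e t) (b t) (f t) (d t)) has_real_derivative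
        sqrt ((c t)^2 - 1) * jacobian_row (c t) (a t) (e t) (b t) (f t) (d t) C A E B F D / q) (at t)"
    unfolding q_def p(2)[symmetric] by (rule dihedral_angle_deriv; fact)
  show "((\<lambda>t. dihedral_angle (d t) (a t) (b t) (e t) (f t) (c t)) has_real_derivative
        sqrt ((d t)^2 - 1) * jacobian_row (d t) (a t) (b t) (e t) (f t) (c t) D A B E F C / q) (at t)"
    unfolding q_def p(3)[symmetric] by (rule dihedral_angle_deriv; fact)
  show "((\<lambda>t. dihedral_angle (e t) (a t) (c t) (d t) (f t) (b t)) has_real_derivative
        sqrt ((e t)^2 - 1) * jacobian_row (e t) (a t) (c t) (d t) (f t) (b t) E A C D F B / q) (at t)"
    unfolding q_def p(4)[symmetric] by (rule dihedral_angle_deriv; fact)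
  show "((\<lambda>t. dihedral_angle (f t) (b t) (c t) (d t) (e t) (a t)) has_real_derivative
        sqrt ((f t)^2 - 1) * jacobian_row (f t) (b t) (c t) (d t) (e t) (a t) F B C D E A / q) (at t)"
    unfolding q_def p(5)[symmetric] by (rule dihedral_angle_deriv; fact)
qed

fun cosh_tuple :: "six \<Rightarrow> six" where
  "cosh_tuple (a, b, c, d, e, f) = (cosh a, cosh b, cosh c, cosh d, cosh e, cosh f)"

fun positive_tuple :: "six \<Rightarrow> bool" where
  "positive_tuple (a, b, c, d, e, f) \<longleftrightarrow> 0 < a \<and> 0 < b \<and> 0 < c \<and> 0 < d \<and> 0 < e \<and> 0 < f"

lemma angles_mono_along_segment:
  fixes l l' :: six
  assumes dom: "\<And>t. t \<in> {0..1} \<Longrightarrow> positive_tuple (l + t *\<^sub>R (l' - l)) \<and> gram_domain (cosh_tuple (l + t *\<^sub>R (l' - l)))"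
    and ne: "l' \<noteq> l"
  shows "0 < (l' - l) \<bullet> (angles (cosh_tuple l') - angles (cosh_tuple l))"
proof -
  obtain a b c d e f where l: "l = (a, b, c, d, e, f)" by (metis prod.exhaust)
  obtain A B C D E F where dl: "l' - l = (A, B, C, D, E, F)" by (metis prod.exhaust)
  define \<phi> where "\<phi> t = (l' - l) \<bullet> angles (cosh_tuple (l + t *\<^sub>R (l' - l)))" for t
  \<comment> \<open>The factor \<open>sqrt (x^2 - 1)\<close> of a row supplies one hyperbolic sine
    and the chain rule for cosh the other, so the derivative of \<open>\<phi>\<close> is the
    quadratic form at a single vector.\<close>
  define Q where "Q t = (let x = (A * sinh (a + t*A), B * sinh (b + t*B), C * sinh (c + t*C), D * sinh (d + t*D),
       E * sinh (e + t*E), F * sinh (f + t*F)) in angle_form (cosh_tuple (l + t *\<^sub>R (l' - l))) x x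
       / sqrt (- gram_det (cosh (a + t*A)) (cosh (b + t*B)) (cosh (c + t*C)) (cosh (d + t*D)) (cosh (e + t*E)) (cosh (f + t*F))))" for t
  have "(\<phi> has_real_derivative Q t) (at t) \<and> Q t > 0" if t: "t \<in> {0..1}" for t
  proof
    have td: "gram_domain (cosh (a + t*A), cosh (b + t*B), cosh (c + t*C), cosh (d + t*D), cosh (e + t*E), cosh (f + t*F))"
      and lp: "0 < a + t*A" "0 < b + t*B" "0 < c + t*C" "0 < d + t*D" "0 < e + t*E" "0 < f + t*F"
      using dom[OF t] unfolding dl unfolding l by auto
    have dc: "((\<lambda>t. cosh (x + t*y)) has_real_derivative y * sinh (x + t*y)) (at t)" for x y :: real
      by (auto intro!: derivative_eq_intros)
    have sq: "sqrt ((cosh x)^2 - 1) = sinh x" if "0 < x" for x :: real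
      using that by (simp add: cosh_square_eq)
    note dv = angles_deriv[OF dc dc dc dc dc dc td]
    show "(\<phi> has_real_derivative Q t) (at t)"
    proof -
      have "\<phi> = (\<lambda>t.
          A * dihedral_angle (cosh (a + t*A)) (cosh (b + t*B)) (cosh (d + t*D)) (cosh (c + t*C)) (cosh (e + t*E)) (cosh (f + t*F))
       + (B * dihedral_angle (cosh (b + t*B)) (cosh (a + t*A)) (cosh (d + t*D)) (cosh (c + t*C)) (cosh (f + t*F)) (cosh (e + t*E))
       + (C * dihedral_angle (cosh (c + t*C)) (cosh (a + t*A)) (cosh (e + t*E)) (cosh (b + t*B)) (cosh (f + t*F)) (cosh (d + t*D))
       + (D * dihedral_angle (cosh (d + t*D)) (cosh (a + t*A)) (cosh (b + t*B)) (cosh (e + t*E)) (cosh (f + t*F)) (cosh (c + t*C))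
       + (E * dihedral_angle (cosh (e + t*E)) (cosh (a + t*A)) (cosh (c + t*C)) (cosh (d + t*D)) (cosh (f + t*F)) (cosh (b + t*B))
       + F * dihedral_angle (cosh (f + t*F)) (cosh (b + t*B)) (cosh (c + t*C)) (cosh (d + t*D)) (cosh (e + t*E)) (cosh (a + t*A)))))))"
        unfolding fun_eq_iff \<phi>_def dl unfolding l by simp
      moreover note DERIV_add[OF DERIV_cmult[OF dv(1), of A] DERIV_add[OF DERIV_cmult[OF dv(2), of B]
        DERIV_add[OF DERIV_cmult[OF dv(3), of C] DERIV_add[OF DERIV_cmult[OF dv(4), of D]
        DERIV_add[OF DERIV_cmult[OF dv(5), of E] DERIV_cmult[OF dv(6), of F]]]]]]
      moreover have "Q t = (A * sinh (a + t*A) * jacobian_row (cosh (a + t*A)) (cosh (b + t*B)) (cosh (d + t*D)) (cosh (c + t*C)) (cosh (e + t*E)) (cosh (f + t*F))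
          (A * sinh (a + t*A)) (B * sinh (b + t*B)) (D * sinh (d + t*D)) (C * sinh (c + t*C)) (E * sinh (e + t*E)) (F * sinh (f + t*F))
       + B * sinh (b + t*B) * jacobian_row (cosh (b + t*B)) (cosh (a + t*A)) (cosh (d + t*D)) (cosh (c + t*C)) (cosh (f + t*F)) (cosh (e + t*E))
          (B * sinh (b + t*B)) (A * sinh (a + t*A)) (D * sinh (d + t*D)) (C * sinh (c + t*C)) (F * sinh (f + t*F)) (E * sinh (e + t*E))
       + C * sinh (c + t*C) * jacobian_row (cosh (c + t*C)) (cosh (a + t*A)) (cosh (e + t*E)) (cosh (b + t*B)) (cosh (f + t*F)) (cosh (d + t*D))
          (C * sinh (c + t*C)) (A * sinh (a + t*A)) (E * sinh (e + t*E)) (B * sinh (b + t*B)) (F * sinh (f + t*F)) (D * sinh (d + t*D))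
       + D * sinh (d + t*D) * jacobian_row (cosh (d + t*D)) (cosh (a + t*A)) (cosh (b + t*B)) (cosh (e + t*E)) (cosh (f + t*F)) (cosh (c + t*C))
          (D * sinh (d + t*D)) (A * sinh (a + t*A)) (B * sinh (b + t*B)) (E * sinh (e + t*E)) (F * sinh (f + t*F)) (C * sinh (c + t*C))
       + E * sinh (e + t*E) * jacobian_row (cosh (e + t*E)) (cosh (a + t*A)) (cosh (c + t*C)) (cosh (d + t*D)) (cosh (f + t*F)) (cosh (b + t*B))
          (E * sinh (e + t*E)) (A * sinh (a + t*A)) (C * sinh (c + t*C)) (D * sinh (d + t*D)) (F * sinh (f + t*F)) (B * sinh (b + t*B))
       + F * sinh (f + t*F) * jacobian_row (cosh (f + t*F)) (cosh (b + t*B)) (cosh (c + t*C)) (cosh (d + t*D)) (cosh (e + t*E)) (cosh (a + t*A))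
          (F * sinh (f + t*F)) (B * sinh (b + t*B)) (C * sinh (c + t*C)) (D * sinh (d + t*D)) (E * sinh (e + t*E)) (A * sinh (a + t*A)))
       / sqrt (- gram_det (cosh (a + t*A)) (cosh (b + t*B)) (cosh (c + t*C)) (cosh (d + t*D)) (cosh (e + t*E)) (cosh (f + t*F)))"
        unfolding Q_def Let_def dl unfolding l by simp
      ultimately show ?thesis
        unfolding sq[OF lp(1)] sq[OF lp(2)] sq[OF lp(3)] sq[OF lp(4)] sq[OF lp(5)] sq[OF lp(6)]
        by (simp only: add_divide_distrib times_divide_eq_right mult.assoc add.assoc)
    qed
    show "Q t > 0"
    proof -
      have "(A * sinh (a + t*A), B * sinh (b + t*B), C * sinh (c + t*C), D * sinh (d + t*D),
         E * sinh (e + t*E), F * sinh (f + t*F)) \<noteq> (0 :: six)"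
      proof -
        have "(A, B, C, D, E, F) \<noteq> 0" using ne dl by auto
        then show ?thesis using lp by (auto simp: zero_prod_def)
      qed
      moreover have "gram_domain (cosh_tuple (l + t *\<^sub>R (l' - l)))" using dom[OF t] by blast
      ultimately show ?thesis unfolding Q_def Let_def using td
        by (intro divide_pos_pos angle_form_pos) simp_all
    qed
  qed
  then have \<phi>: "(\<phi> has_real_derivative Q t) (at t)" "Q t > 0" if "0 \<le> t" "t \<le> 1" for t
    using that by simp_all
  obtain z where "0 < z" "z < 1" "\<phi> 1 - \<phi> 0 = (1 - 0) * Q z"
    using MVT2[of 0 1 \<phi> Q] \<phi>(1) by auto
  then have "\<phi> 1 - \<phi> 0 > 0" using \<phi>(2)[of z] by simp
  then show ?thesis by (simp add: \<phi>_def inner_diff_right)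
qed

lemma open_length_domain: "open {l. positive_tuple l \<and> gram_domain (cosh_tuple l)}"
proof -
  have "{l. positive_tuple l \<and> gram_domain (cosh_tuple l)} = {l. 0 < fst l \<and> 0 < fst (snd l) \<and> 0 < fst (snd (snd l)) \<and>
     0 < fst (snd (snd (snd l))) \<and> 0 < fst (snd (snd (snd (snd l)))) \<and> 0 < snd (snd (snd (snd (snd l)))) \<and>
     1 < cosh (fst l) \<and> 1 < cosh (fst (snd l)) \<and> 1 < cosh (fst (snd (snd l))) \<and>
     1 < cosh (fst (snd (snd (snd l)))) \<and> 1 < cosh (fst (snd (snd (snd (snd l))))) \<and> 1 < cosh (snd (snd (snd (snd (snd l))))) \<and>
     gram_det (cosh (fst l)) (cosh (fst (snd l))) (cosh (fst (snd (snd l))))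
      (cosh (fst (snd (snd (snd l))))) (cosh (fst (snd (snd (snd (snd l)))))) (cosh (snd (snd (snd (snd (snd l)))))) < 0}"
    by auto
  moreover have "open \<dots>"
    unfolding gram_det_def by (intro open_Collect_conj open_Collect_less continuous_intros)
  ultimately show ?thesis by simp
qed

lemma angles_locally_monotone:
  assumes "positive_tuple l" "gram_domain (cosh_tuple l)"
  shows "\<exists>\<delta>>0. \<forall>l'. dist l l' < \<delta> \<longrightarrow> l' \<noteq> l \<longrightarrow> 0 < (l' - l) \<bullet> (angles (cosh_tuple l') - angles (cosh_tuple l))"
proof -
  obtain \<delta> where d: "\<delta> > 0" "ball l \<delta> \<subseteq> {l. positive_tuple l \<and> gram_domain (cosh_tuple l)}"
    using open_length_domain assms open_contains_ball_eq by blast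
  have "0 < (l' - l) \<bullet> (angles (cosh_tuple l') - angles (cosh_tuple l))" if l': "dist l l' < \<delta>" "l' \<noteq> l" for l'
  proof (rule angles_mono_along_segment[OF _ l'(2)])
    fix t :: real assume t: "t \<in> {0..1}"
    have "(1 - t) *\<^sub>R l + t *\<^sub>R l' \<in> ball l \<delta>"
      using t d(1) l' by (intro convexD[OF convex_ball]) auto
    also have "(1 - t) *\<^sub>R l + t *\<^sub>R l' = l + t *\<^sub>R (l' - l)" by (simp add: algebra_simps)
    finally show "positive_tuple (l + t *\<^sub>R (l' - l)) \<and> gram_domain (cosh_tuple (l + t *\<^sub>R (l' - l)))" using d(2) by blast
  qed
  then show ?thesis using d(1) by blast
qed

lemma corner_pairs: "{(a, b). a < (b::4)} = {(0, 1), (0, 2), (0, 3), (1, 2), (1, 3), (2, 3)}"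
proof -
  have "(a, b) \<in> {(a, b). a < b} \<longleftrightarrow> (a, b) \<in> {(0, 1), (0, 2), (0, 3), (1, 2), (1, 3), (2, 3)}" for a b :: 4
  proof -
    have "\<forall>a b::4. (a, b) \<in> {(a, b). a < b} \<longleftrightarrow> (a, b) \<in> {(0, 1), (0, 2), (0, 3), (1, 2), (1, 3), (2, 3)}"
      unfolding forall_corners using corners_less by (simp add: corners_less[THEN less_imp_not_less])
    then show ?thesis by blast
  qed
  then show ?thesis by (intro subset_antisym subrelI) blast+
qed

lemma dihedral_locally_monotone:
  assumes h0: "hyperideal_tet l0"
  shows "\<exists>\<delta>>0. \<forall>l. hyperideal_tet l \<longrightarrow> (\<forall>a b. a \<noteq> b \<longrightarrow> \<bar>l a b - l0 a b\<bar> < \<delta>) \<longrightarrow>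
     (\<exists>a b. a < b \<and> l a b \<noteq> l0 a b) \<longrightarrow>
     0 < (\<Sum>(a, b)\<in>{(a, b). a < b}. (l a b - l0 a b) * (dihedral l a b - dihedral l0 a b))"
proof -
  have cosh_edges: "cosh_edges l = cosh_tuple (edge_tuple l)" for l by (simp add: cosh_edges_def edge_tuple_def)
  have "positive_tuple (edge_tuple l0)" using h0 by (auto simp: hyperideal_tet_def edge_tuple_def)
  then obtain \<delta> where d: "\<delta> > 0" "\<And>l'. dist (edge_tuple l0) l' < \<delta> \<Longrightarrow> l' \<noteq> edge_tuple l0 \<Longrightarrow>
      0 < (l' - edge_tuple l0) \<bullet> (angles (cosh_tuple l') - angles (cosh_tuple (edge_tuple l0)))"
    using angles_locally_monotone hyperideal_gram_domain[OF h0] unfolding cosh_edges by blast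
  have "0 < (\<Sum>(a, b)\<in>{(a, b). a < b}. (l a b - l0 a b) * (dihedral l a b - dihedral l0 a b))"
    \<comment> \<open>The norm of a six-tuple is at most the sum of its six absolute values, hence
      the sixth of \<open>\<delta>\<close>.\<close>
    if h: "hyperideal_tet l" and near: "\<forall>a b. a \<noteq> b \<longrightarrow> \<bar>l a b - l0 a b\<bar> < \<delta> / 6"
      and ne: "\<exists>a b. a < b \<and> l a b \<noteq> l0 a b" for l
  proof -
    have nr: "\<bar>l 0 1 - l0 0 1\<bar> < \<delta> / 6" "\<bar>l 0 2 - l0 0 2\<bar> < \<delta> / 6" "\<bar>l 0 3 - l0 0 3\<bar> < \<delta> / 6"
       "\<bar>l 1 2 - l0 1 2\<bar> < \<delta> / 6" "\<bar>l 1 3 - l0 1 3\<bar> < \<delta> / 6" "\<bar>l 2 3 - l0 2 3\<bar> < \<delta> / 6"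
      using near by simp_all
    have "norm (A, B, C, D, E, F) \<le> \<bar>A\<bar> + \<bar>B\<bar> + \<bar>C\<bar> + \<bar>D\<bar> + \<bar>E\<bar> + \<bar>F\<bar>" for A B C D E F :: real
      using norm_Pair_le[of A "(B, C, D, E, F)"] norm_Pair_le[of B "(C, D, E, F)"]
        norm_Pair_le[of C "(D, E, F)"] norm_Pair_le[of D "(E, F)"] norm_Pair_le[of E F] by simp
    then have "dist (edge_tuple l0) (edge_tuple l) \<le> \<bar>l 0 1 - l0 0 1\<bar> + \<bar>l 0 2 - l0 0 2\<bar> + \<bar>l 0 3 - l0 0 3\<bar>
       + \<bar>l 1 2 - l0 1 2\<bar> + \<bar>l 1 3 - l0 1 3\<bar> + \<bar>l 2 3 - l0 2 3\<bar>"
      unfolding dist_norm norm_minus_commute[of "edge_tuple l0"] by (simp add: edge_tuple_def)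
    then have "dist (edge_tuple l0) (edge_tuple l) < \<delta>" using nr by linarith
    moreover have "edge_tuple l \<noteq> edge_tuple l0"
    proof
      assume eq: "edge_tuple l = edge_tuple l0"
      obtain a b where "(a, b) \<in> {(a, b). a < b}" "l a b \<noteq> l0 a b" using ne by auto
      then show False using eq unfolding corner_pairs edge_tuple_def by auto
    qed
    ultimately have "0 < (edge_tuple l - edge_tuple l0) \<bullet> (edge_tuple (dihedral l) - edge_tuple (dihedral l0))"
      using d(2) dihedral_eq_angles[OF h] dihedral_eq_angles[OF h0] cosh_edges by metis
    then show ?thesis unfolding corner_pairs by (simp add: edge_tuple_def inner_prod_def)
  qed
  then show ?thesis using d(1) by (intro exI[of _ "\<delta> / 6"]) auto
qed

section \<open>Rigidity\<close>

lemma cos_weight_pos: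
  assumes "0 \<le> \<phi>" "\<phi> \<le> arccos (1/3)"
  shows "0 < cos \<phi>"
proof -
  have "cos (arccos (1/3)) \<le> cos \<phi>"
    using assms arccos_bounded[of "1/3"] by (intro cos_monotone_0_pi_le) auto
  then show ?thesis by simp
qed

lemma len_arg_commute: "len_arg \<phi> x y = len_arg \<phi> y x"
  by (simp add: len_arg_def mult_ac)

text \<open>The sinh product already grows strictly; positivity of \<open>cos \<phi>\<close> is what
  keeps the cosh term from working against it. The second radius is compared only weakly, so that
  the sign argument also covers a radius that stays fixed.\<close>

lemma len_arg_strict_mono:
  assumes "0 < cos \<phi>" "0 < x" "x < x'" "0 < y" "y \<le> y'"
  shows "len_arg \<phi> x y < len_arg \<phi> x' y'"
proof -
  have "sinh x * sinh y < sinh x' * sinh y"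
    using assms by (intro mult_strict_right_mono) auto
  also have "\<dots> \<le> sinh x' * sinh y'"
    using assms by (intro mult_left_mono) auto
  finally have "sinh x * sinh y < sinh x' * sinh y'" .
  moreover have "cosh x * cosh y \<le> cosh x' * cosh y'"
    using assms by (intro mult_mono) (auto simp: cosh_real_nonneg_le_iff)
  then have "cos \<phi> * (cosh x * cosh y) \<le> cos \<phi> * (cosh x' * cosh y')"
    using assms(1) by (intro mult_left_mono) auto
  ultimately show ?thesis unfolding len_arg_def by (simp add: mult.assoc)
qed

lemma radii_determined_by_lengths:
  fixes x x' :: "4 \<Rightarrow> real"
  assumes pos: "\<And>a. 0 < x a" "\<And>a. 0 < x' a" and w: "\<And>a b. a \<noteq> b \<Longrightarrow> 0 < cos (\<phi> a b)"
    and eq: "\<And>a b. a < b \<Longrightarrow> len_arg (\<phi> a b) (x a) (x b) = len_arg (\<phi> a b) (x' a) (x' b)"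
  shows "x a = x' a"
proof -
  have *: "\<not> (x a < x' a \<and> x b \<le> x' b)" "\<not> (x' a < x a \<and> x' b \<le> x b)" if "a \<noteq> b" for a b
  proof -
    obtain c d where "c \<noteq> d" and e: "len_arg (\<phi> c d) (x a) (x b) = len_arg (\<phi> c d) (x' a) (x' b)"
    proof (cases "a < b")
      case True
      show ?thesis by (rule that[OF \<open>a \<noteq> b\<close> eq[OF True]])
    next
      case False
      then have "b < a" using \<open>a \<noteq> b\<close> by simp
      from eq[OF this] have "len_arg (\<phi> b a) (x a) (x b) = len_arg (\<phi> b a) (x' a) (x' b)"
        unfolding len_arg_commute[of _ "x b"] len_arg_commute[of _ "x' b"] .
      then show ?thesis using \<open>a \<noteq> b\<close> by (intro that[of b a]) auto
    qed
    show "\<not> (x a < x' a \<and> x b \<le> x' b)" "\<not> (x' a < x a \<and> x' b \<le> x b)"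
      using len_arg_strict_mono[OF w[OF \<open>c \<noteq> d\<close>], of "x a" "x' a" "x b" "x' b"]
        len_arg_strict_mono[OF w[OF \<open>c \<noteq> d\<close>], of "x' a" "x a" "x' b" "x b"] pos e by auto
  qed
  \<comment> \<open>Addition of corners is modulo 4, so these are three distinct corners for every
    \<open>a\<close>.\<close>
  have bc: "a \<noteq> a + 1" "a \<noteq> a + 2" "a + 1 \<noteq> a + 2" by simp_all
  show ?thesis
    using *[OF bc(1)] *[OF bc(2)] *[OF bc(3)] by force
qed

lemma finite_uniform_radius:
  fixes P :: "'a \<Rightarrow> real \<Rightarrow> bool"
  assumes "finite A" "\<And>x. x \<in> A \<Longrightarrow> \<exists>e>0. P x e" "\<And>x e e'. P x e \<Longrightarrow> e' \<le> e \<Longrightarrow> P x e'"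
  shows "\<exists>e>0. \<forall>x\<in>A. P x e"
  using assms(1,2)
proof (induction A rule: finite_induct)
  case (insert a A)
  obtain e where "e > 0" "\<forall>x\<in>A. P x e" using insert by auto
  moreover obtain e' where "e' > 0" "P a e'" using insert by auto
  ultimately show ?case using assms(3) by (intro exI[of _ "min e e'"]) (auto dest: assms(3))
qed (auto intro: exI[of _ 1])

lemma arcosh_len_arg_continuous:
  assumes "1 < len_arg \<phi> x0 y0" "0 < \<delta>"
  shows "\<exists>\<epsilon>>0. \<forall>x y. \<bar>x - x0\<bar> < \<epsilon> \<longrightarrow> \<bar>y - y0\<bar> < \<epsilon> \<longrightarrow>
    \<bar>arcosh (len_arg \<phi> x y) - arcosh (len_arg \<phi> x0 y0)\<bar> < \<delta>"
proof -
  have "isCont (\<lambda>p. arcosh (len_arg \<phi> (fst p) (snd p))) (x0, y0)"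
    using assms(1) unfolding len_arg_def by (intro continuous_intros isCont_o2[OF _ isCont_arcosh]) auto
  then obtain d where d: "d > 0" "\<And>p. dist p (x0, y0) < d \<Longrightarrow>
      dist (arcosh (len_arg \<phi> (fst p) (snd p))) (arcosh (len_arg \<phi> x0 y0)) < \<delta>"
    using assms(2) unfolding continuous_at_eps_delta by fastforce
  have "\<bar>arcosh (len_arg \<phi> x y) - arcosh (len_arg \<phi> x0 y0)\<bar> < \<delta>"
    if "\<bar>x - x0\<bar> < d / 2" "\<bar>y - y0\<bar> < d / 2" for x y
  proof -
    have "dist (x, y) (x0, y0) \<le> \<bar>x - x0\<bar> + \<bar>y - y0\<bar>"
      using norm_Pair_le[of "x - x0" "y - y0"] by (simp add: dist_norm)
    then have "dist (x, y) (x0, y0) < d" using that by linarith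
    from d(2)[OF this] show ?thesis by (simp add: dist_real_def)
  qed
  then show ?thesis using d(1) by (intro exI[of _ "d / 2"]) auto
qed

text \<open>Gluing may reverse an edge, so along a chain of \<open>edge_step\<close> only the
  unordered pair of end vertices is preserved. This suffices, because the length formula is
  symmetric in the two radii.\<close>

lemma tet_len_edge_invariant:
  assumes tri: "ideal_triangulation N T vert fp fg E edge"
    and t: "t \<in> T" "t' \<in> T" "a \<noteq> b" "a' \<noteq> b'" and e: "edge t a b = edge t' a' b'"
  shows "tet_len vert edge \<Phi> r t a b = tet_len vert edge \<Phi> r t' a' b'"
proof -
  note tri' = tri[unfolded ideal_triangulation_def]
  have fpT: "fst (fp (s, h)) \<in> T" if "s \<in> T" for s h
    using tri'[THEN conjunct2, THEN conjunct2, THEN conjunct2, THEN conjunct1] that by blast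
  have vert: "vert s x = vert s' x' \<longleftrightarrow> ((s, x), (s', x')) \<in> (corner_step fp fg T)\<^sup>*"
    if "s \<in> T" "s' \<in> T" for s x s' x'
    using tri'[THEN conjunct2, THEN conjunct2, THEN conjunct2, THEN conjunct2, THEN conjunct2, THEN conjunct2, THEN conjunct1]
      that by blast
  have vstep: "vert (fst (fp (s, h))) (fg (s, h) x) = vert s x" if "s \<in> T" "x \<noteq> h" for s x h
  proof -
    have "((s, x), (fst (fp (s, h)), fg (s, h) x)) \<in> corner_step fp fg T"
      using that unfolding corner_step_def by blast
    then show ?thesis using vert[OF that(1) fpT[OF that(1)]] by (metis r_into_rtrancl)
  qed
  have "((t, a, b), (t', a', b')) \<in> (edge_step fp fg T)\<^sup>*"
    using tri'[THEN conjunct2, THEN conjunct2, THEN conjunct2, THEN conjunct2, THEN conjunct2, THEN conjunct2,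
        THEN conjunct2, THEN conjunct2, THEN conjunct2] t e by blast
  moreover have "fst y \<in> T \<and>
      (vert (fst y) (fst (snd y)) = vert t a \<and> vert (fst y) (snd (snd y)) = vert t b \<or>
       vert (fst y) (fst (snd y)) = vert t b \<and> vert (fst y) (snd (snd y)) = vert t a)"
    if "((t, a, b), y) \<in> (edge_step fp fg T)\<^sup>*" for y
    using that
  proof (induction rule: rtrancl_induct)
    case base
    then show ?case using t by simp
  next
    case (step y y')
    obtain s x z where y: "y = (s, x, z)" by (rule prod_cases3)
    from step(2) consider
        h where "y' = (fst (fp (s, h)), fg (s, h) x, fg (s, h) z)" "s \<in> T" "x \<noteq> h" "z \<noteq> h"
      | "y' = (s, z, x)"
      unfolding edge_step_def y by auto
    then show ?case
    proof cases
      case (1 h)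
      then show ?thesis using step(3) vstep[OF 1(2,3)] vstep[OF 1(2,4)] fpT[OF 1(2)] by (simp add: y)
    next
      case 2
      then show ?thesis using step(3) by (auto simp: y)
    qed
  qed
  ultimately have "(vert t' a' = vert t a \<and> vert t' b' = vert t b) \<or> (vert t' a' = vert t b \<and> vert t' b' = vert t a)"
    by fastforce
  then show ?thesis unfolding tet_len_def e by (auto simp: len_arg_commute)
qed

lemma tet_rigid_nearby:
  assumes t: "t \<in> T" and vert: "\<And>a. vert t a \<in> {1..N}"
    and rbar: "rbar \<in> admissible N T vert edge \<Phi>"
  shows "\<exists>\<epsilon>>0. \<forall>r\<in>admissible N T vert edge \<Phi>. (\<forall>i\<in>{1..N}. \<bar>r i - rbar i\<bar> < \<epsilon>) \<longrightarrow>
    (\<exists>a b. a < b \<and> tet_len vert edge \<Phi> r t a b \<noteq> tet_len vert edge \<Phi> rbar t a b) \<longrightarrow>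
    0 < (\<Sum>(a, b)\<in>{(a, b). a < b}. (tet_len vert edge \<Phi> r t a b - tet_len vert edge \<Phi> rbar t a b)
        * (dihedral (tet_len vert edge \<Phi> r t) a b - dihedral (tet_len vert edge \<Phi> rbar t) a b))"
proof -
  let ?L = "\<lambda>r. tet_len vert edge \<Phi> r t"
  have hyp: "hyperideal_tet (?L r)" if "r \<in> admissible N T vert edge \<Phi>" for r
    using that t unfolding admissible_def by blast
  obtain \<delta> where d: "\<delta> > 0" "\<And>l. hyperideal_tet l \<Longrightarrow> (\<forall>a b. a \<noteq> b \<longrightarrow> \<bar>l a b - ?L rbar a b\<bar> < \<delta>) \<Longrightarrow>
     (\<exists>a b. a < b \<and> l a b \<noteq> ?L rbar a b) \<Longrightarrow>
     0 < (\<Sum>(a, b)\<in>{(a, b). a < b}. (l a b - ?L rbar a b) * (dihedral l a b - dihedral (?L rbar) a b))"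
    using dihedral_locally_monotone[OF hyp[OF rbar]] by blast
  have "\<exists>\<epsilon>>0. \<forall>p\<in>UNIV. fst p \<noteq> snd p \<longrightarrow>
      (\<forall>x y. \<bar>x - rbar (vert t (fst p))\<bar> < \<epsilon> \<longrightarrow> \<bar>y - rbar (vert t (snd p))\<bar> < \<epsilon> \<longrightarrow>
        \<bar>arcosh (len_arg (\<Phi> (edge t (fst p) (snd p))) x y) - ?L rbar (fst p) (snd p)\<bar> < \<delta>)"
  proof (rule finite_uniform_radius)
    fix p :: "4 \<times> 4"
    show "\<exists>\<epsilon>>0. fst p \<noteq> snd p \<longrightarrow>
      (\<forall>x y. \<bar>x - rbar (vert t (fst p))\<bar> < \<epsilon> \<longrightarrow> \<bar>y - rbar (vert t (snd p))\<bar> < \<epsilon> \<longrightarrow>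
        \<bar>arcosh (len_arg (\<Phi> (edge t (fst p) (snd p))) x y) - ?L rbar (fst p) (snd p)\<bar> < \<delta>)"
    proof (cases "fst p = snd p")
      case False
      let ?z = "len_arg (\<Phi> (edge t (fst p) (snd p))) (rbar (vert t (fst p))) (rbar (vert t (snd p)))"
      have "1 \<le> ?z" using rbar t False unfolding admissible_def by blast
      \<comment> \<open>Admissibility gives only the weak bound; since \<open>arcosh 1 = 0\<close>,
        positive length excludes the value 1.\<close>
      moreover have "0 < arcosh ?z"
        using hyp[OF rbar] False unfolding hyperideal_tet_def tet_len_def by blast
      ultimately have "1 < ?z" by (cases "?z = 1") auto
      then show ?thesis using arcosh_len_arg_continuous[OF _ d(1)] unfolding tet_len_def by blast
    qed (auto intro: exI[of _ 1])
  qed (auto intro: less_le_trans)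
  then obtain \<epsilon> where e: "\<epsilon> > 0" "\<And>a b x y. a \<noteq> b \<Longrightarrow> \<bar>x - rbar (vert t a)\<bar> < \<epsilon> \<Longrightarrow> \<bar>y - rbar (vert t b)\<bar> < \<epsilon> \<Longrightarrow>
        \<bar>arcosh (len_arg (\<Phi> (edge t a b)) x y) - ?L rbar a b\<bar> < \<delta>"
    by auto
  show ?thesis
  proof (intro exI conjI ballI impI)
    show "\<epsilon> > 0" by fact
    fix r assume r: "r \<in> admissible N T vert edge \<Phi>" and near: "\<forall>i\<in>{1..N}. \<bar>r i - rbar i\<bar> < \<epsilon>"
      and ne: "\<exists>a b. a < b \<and> ?L r a b \<noteq> ?L rbar a b"
    have "\<forall>a b. a \<noteq> b \<longrightarrow> \<bar>?L r a b - ?L rbar a b\<bar> < \<delta>"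
    proof (intro allI impI)
      fix a b :: 4 assume "a \<noteq> b"
      from e(2)[OF this, of "r (vert t a)" "r (vert t b)"] near vert
      show "\<bar>?L r a b - ?L rbar a b\<bar> < \<delta>" by (simp add: tet_len_def[of vert edge \<Phi> r])
    qed
    from d(2)[OF hyp[OF r] this ne]
    show "0 < (\<Sum>(a, b)\<in>{(a, b). a < b}. (?L r a b - ?L rbar a b) * (dihedral (?L r) a b - dihedral (?L rbar) a b))" .
  qed
qed

theorem theorem1p3:
  fixes N :: nat and T :: "'t set" and vert :: "'t \<Rightarrow> 4 \<Rightarrow> nat"
    and fp :: "'t \<times> 4 \<Rightarrow> 't \<times> 4" and fg :: "'t \<times> 4 \<Rightarrow> 4 \<Rightarrow> 4"
    and E :: "'e set" and edge :: "'t \<Rightarrow> 4 \<Rightarrow> 4 \<Rightarrow> 'e"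
    and \<Phi> :: "'e \<Rightarrow> real" and rbar :: "nat \<Rightarrow> real"
  assumes "ideal_triangulation N T vert fp fg E edge"
    and "\<forall>e\<in>E. 0 \<le> \<Phi> e \<and> \<Phi> e \<le> arccos (1/3)"
    and "rbar \<in> admissible N T vert edge \<Phi>"
  shows "\<exists>\<epsilon>>0. \<forall>r \<in> admissible N T vert edge \<Phi>.
           (\<forall>i\<in>{1..N}. \<bar>r i - rbar i\<bar> < \<epsilon>) \<longrightarrow>
           (\<forall>e\<in>E. ricci T vert edge \<Phi> r e = ricci T vert edge \<Phi> rbar e) \<longrightarrow>
           r = rbar"
proof -
  note tri = assms(1)[unfolded ideal_triangulation_def]
  have fin: "finite T" "finite E" using tri by simp_all
  have vert: "vert t a \<in> {1..N}" if "t \<in> T" for t a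
    using tri[THEN conjunct2, THEN conjunct2, THEN conjunct2, THEN conjunct2, THEN conjunct1] that by blast
  have vsurj: "\<exists>t\<in>T. \<exists>a. vert t a = i" if "i \<in> {1..N}" for i
    using tri[THEN conjunct2, THEN conjunct2, THEN conjunct2, THEN conjunct2, THEN conjunct2, THEN conjunct1] that by blast
  have edgeE: "edge t a b \<in> E" if "t \<in> T" "a \<noteq> b" for t a b
    using tri[THEN conjunct2, THEN conjunct2, THEN conjunct2, THEN conjunct2, THEN conjunct2, THEN conjunct2,
        THEN conjunct2, THEN conjunct1] that by blast
  let ?L = "\<lambda>r t. tet_len vert edge \<Phi> r t"
  let ?P = "{(a, b). a < (b::4)}"
  let ?S = "\<lambda>r t. \<Sum>(a, b)\<in>?P. (?L r t a b - ?L rbar t a b) * (dihedral (?L r t) a b - dihedral (?L rbar t) a b)"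
  have "\<exists>\<epsilon>>0. \<forall>t\<in>T. \<forall>r\<in>admissible N T vert edge \<Phi>. (\<forall>i\<in>{1..N}. \<bar>r i - rbar i\<bar> < \<epsilon>) \<longrightarrow>
    (\<exists>a b. a < b \<and> ?L r t a b \<noteq> ?L rbar t a b) \<longrightarrow> 0 < ?S r t"
  proof (rule finite_uniform_radius[OF fin(1)])
    show "\<exists>\<epsilon>>0. \<forall>r\<in>admissible N T vert edge \<Phi>. (\<forall>i\<in>{1..N}. \<bar>r i - rbar i\<bar> < \<epsilon>) \<longrightarrow>
      (\<exists>a b. a < b \<and> ?L r t a b \<noteq> ?L rbar t a b) \<longrightarrow> 0 < ?S r t" if "t \<in> T" for t
      using tet_rigid_nearby[OF that vert[OF that] assms(3)] .
  next
    fix t and e e' :: real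
    assume *: "\<forall>r\<in>admissible N T vert edge \<Phi>. (\<forall>i\<in>{1..N}. \<bar>r i - rbar i\<bar> < e) \<longrightarrow>
      (\<exists>a b. a < b \<and> ?L r t a b \<noteq> ?L rbar t a b) \<longrightarrow> 0 < ?S r t" and "e' \<le> e"
    then show "\<forall>r\<in>admissible N T vert edge \<Phi>. (\<forall>i\<in>{1..N}. \<bar>r i - rbar i\<bar> < e') \<longrightarrow>
      (\<exists>a b. a < b \<and> ?L r t a b \<noteq> ?L rbar t a b) \<longrightarrow> 0 < ?S r t"
      by (meson less_le_trans)
  qed
  then obtain \<epsilon> where e: "\<epsilon> > 0" "\<And>t r. t \<in> T \<Longrightarrow> r \<in> admissible N T vert edge \<Phi> \<Longrightarrow>
      (\<forall>i\<in>{1..N}. \<bar>r i - rbar i\<bar> < \<epsilon>) \<Longrightarrow> (\<exists>a b. a < b \<and> ?L r t a b \<noteq> ?L rbar t a b) \<Longrightarrow> 0 < ?S r t"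
    by blast
  show ?thesis
  proof (intro exI conjI ballI impI)
    show "\<epsilon> > 0" by fact
    fix r assume r: "r \<in> admissible N T vert edge \<Phi>" and near: "\<forall>i\<in>{1..N}. \<bar>r i - rbar i\<bar> < \<epsilon>"
      and K: "\<forall>e\<in>E. ricci T vert edge \<Phi> r e = ricci T vert edge \<Phi> rbar e"
    \<comment> \<open>The contribution of one tetrahedron edge to the pairing. Its total is
      evaluated by grouping over the edges of the triangulation, and bounded by grouping over
      tetrahedra.\<close>
    define h where "h = (\<lambda>(t, a, b). (?L r t a b - ?L rbar t a b) * (dihedral (?L r t) a b - dihedral (?L rbar t) a b))"
    have finP: "finite ?P" unfolding corner_pairs by simp
    have edge0: "sum h {x \<in> T \<times> ?P. (\<lambda>(t, a, b). edge t a b) x = e} = 0" if "e \<in> E" for e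
    proof -
      let ?W = "{(t, a, b). t \<in> T \<and> a < b \<and> edge t a b = e}"
      have W: "{x \<in> T \<times> ?P. (\<lambda>(t, a, b). edge t a b) x = e} = ?W" by auto
      show ?thesis
      proof (cases "?W = {}")
        case False
        then obtain s a0 b0 where s: "s \<in> T" "a0 < b0" "edge s a0 b0 = e" by auto
        have "sum h ?W = (\<Sum>(t, a, b)\<in>?W. (?L r s a0 b0 - ?L rbar s a0 b0)
            * (dihedral (?L r t) a b - dihedral (?L rbar t) a b))"
        proof (rule sum.cong[OF refl])
          fix x assume "x \<in> ?W"
          then obtain t a b where x: "x = (t, a, b)" "t \<in> T" "a < b" "edge t a b = e" by auto
          have "?L r' t a b = ?L r' s a0 b0" for r'
            by (rule tet_len_edge_invariant[OF assms(1)]) (use x s in auto)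
          then show "h x = (case x of (t, a, b) \<Rightarrow> (?L r s a0 b0 - ?L rbar s a0 b0)
            * (dihedral (?L r t) a b - dihedral (?L rbar t) a b))"
            unfolding h_def x by simp
        qed
        \<comment> \<open>The length difference is constant on an edge class and factors out; what
          remains is the difference of total angles, that is, minus the curvature
          difference.\<close>
        also have "\<dots> = (?L r s a0 b0 - ?L rbar s a0 b0) *
           ((\<Sum>(t, a, b)\<in>?W. dihedral (?L r t) a b) - (\<Sum>(t, a, b)\<in>?W. dihedral (?L rbar t) a b))"
          by (simp add: case_prod_unfold sum_subtractf flip: sum_distrib_left)
        also have "\<dots> = 0" using K that unfolding ricci_def by simp
        finally show ?thesis unfolding W .
      next
        case True
        show ?thesis unfolding W True by (rule sum.empty)
      qed
    qed
    have "(\<Sum>t\<in>T. ?S r t) = sum h (T \<times> ?P)"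
      unfolding h_def by (subst sum.cartesian_product) (simp add: case_prod_unfold)
    also have "\<dots> = (\<Sum>e\<in>E. sum h {x \<in> T \<times> ?P. (\<lambda>(t, a, b). edge t a b) x = e})"
      by (rule sum.group[symmetric]) (use fin finP edgeE in auto)
    also have "\<dots> = 0" using edge0 by simp
    finally have tot: "(\<Sum>t\<in>T. ?S r t) = 0" .
    \<comment> \<open>A tetrahedron with unchanged lengths contributes 0 and any other a positive
      amount, so the vanishing total leaves only the first kind.\<close>
    have nn: "?S r t \<ge> 0" if "t \<in> T" for t
    proof (cases "\<exists>a b. a < b \<and> ?L r t a b \<noteq> ?L rbar t a b")
      case True
      then show ?thesis using e(2)[OF that r near] by simp
    next
      case False
      then have "?S r t = 0" by (intro sum.neutral) auto
      then show ?thesis by simp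
    qed
    have len: "?L r t a b = ?L rbar t a b" if "t \<in> T" "a < b" for t a b
    proof -
      have "?S r t = 0" using sum_nonneg_0[OF fin(1), of "?S r", OF nn tot that(1)] .
      then show ?thesis using e(2)[OF that(1) r near] that(2) by (metis less_irrefl)
    qed
    have "r i = rbar i" if i: "i \<in> {1..N}" for i
    proof -
      obtain t a where t: "t \<in> T" "vert t a = i" using vsurj[OF i] by blast
      have "r (vert t a) = rbar (vert t a)"
      proof (rule radii_determined_by_lengths[where x = "\<lambda>a. r (vert t a)" and x' = "\<lambda>a. rbar (vert t a)"
             and \<phi> = "\<lambda>a b. \<Phi> (edge t a b)"])
        show "0 < r (vert t a)" "0 < rbar (vert t a)" for a
          using r assms(3) vert[OF t(1)] unfolding admissible_def by auto
        show "0 < cos (\<Phi> (edge t a b))" if "a \<noteq> b" for a b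
          using assms(2) edgeE[OF t(1) that] cos_weight_pos by blast
        fix a b :: 4 assume ab: "a < b"
        \<comment> \<open>Equal lengths give equal arguments of arcosh only where cosh inverts it,
          which this bound ensures.\<close>
        have "1 \<le> len_arg (\<Phi> (edge t a b)) (r' (vert t a)) (r' (vert t b))"
          if "r' \<in> admissible N T vert edge \<Phi>" for r'
          using that t(1) ab unfolding admissible_def by auto
        then show "len_arg (\<Phi> (edge t a b)) (r (vert t a)) (r (vert t b))
            = len_arg (\<Phi> (edge t a b)) (rbar (vert t a)) (rbar (vert t b))"
          using len[OF t(1) ab] r assms(3) unfolding tet_len_def by (metis cosh_arcosh_real)
      qed
      then show ?thesis using t by simp
    qed
    moreover have "r i = rbar i" if "i \<notin> {1..N}" for i
      using that r assms(3) unfolding admissible_def by auto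
    ultimately show "r = rbar" by blast
  qed
qed

end
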